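(* Let $x_1,x_2,\dots$ be a sample of a stationary ergodic process $\{X_t\}_{t\in\mathbb{Z}}$ over a finite alphabet $A$, with context tree $\mathcal{T}_0$, satisfying $\alpha_0>0$ and $\alpha=\sum_{k\in\mathbb{N}}(1-\alpha_k)<+\infty$. Let $K\in\mathbb{N}$ be a constant. Let $f$ be any penalizing term and let $d(n)<n$ be any integer-valued function growing to infinity with $n$ such that for any constant $c>0$ $$\sum_{n\in\mathbb{N}}|A|^{d(n)}\exp\Bigl[-\frac{f(n)\,c^{d(n)}}{d(n)}\Bigr]<+\infty .$$ Let $\hat{\mathcal{T}}(x_1^n)$ be the penalized likelihood context tree estimator with penalizing term $f$ and maximal height $d(n)$. Then, with probability one, there exists an integer $n_0$ (which may depend on the realization of the process) such that $\hat{\mathcal{T}}(x_1^n)|_K=\mathcal{T}_0|_K$ for any $n\ge n_0$.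
   Context: Sequences and trees. $A$ is a finite alphabet with $|A|$ symbols; $A^j$ is the set of sequences of length $j$ over $A$; $w_m^n=(w_m,\dots,w_n)$ has length $\ell(w_m^n)=n-m+1$; $\lambda$ is the empty string, of length $0$; $vw$ denotes concatenation ($v$ followed by $w$, where $v$ may be semi-infinite, $v=(\dots,v_{-2},v_{-1})=v_{-\infty}^{-1}$). Semi-infinite sequences have length $+\infty$. $s\prec w$ (equivalently $w\succ s$) means that $s$ is a suffix of $w$: there is $u$ with $\ell(u)\ge1$ and $w=us$; $s\preceq w$ means $s\prec w$ or $s=w$. A tree is a set $\mathcal{T}$ of finite or semi-infinite sequences such that no $s\in\mathcal{T}$ is a suffix of another $w\in\mathcal{T}$. Its height is $h(\mathcal{T})=\sup\{\ell(w):w\in\mathcal{T}\}$; if the height is finite, $|\mathcal{T}|$ is the number of sequences in $\mathcal{T}$. The truncation to level $K$ is $\mathcal{T}|_K=\{w\in\mathcal{T}:\ell(w)\le K\}\cup\{w:\ell(w)=K,\ w\prec u\text{ for some }u\in\mathcal{T}\}$. $\mathcal{T}$ is complete if every semi-infinite sequence $w_{-\infty}^{-1}$ over $A$ satisfies $s\preceq w_{-\infty}^{-1}$ for some $s\in\mathcal{T}$. Process and context tree. For $w\in A^j$, $p(w)=\mathbb{P}(X_1^j=w)$, and if $p(w)>0$, $p(a|w)=\mathbb{P}(X_0=a\mid X_{-j}^{-1}=w)$; for semi-infinite $w$, $p(a|w)=\mathbb{P}(X_0=a\mid X_{-\infty}^{-1}=w)$. A sequence $w\in A^j$ is a context if (1)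 for every semi-infinite $x_{-\infty}^{-1}$ having $w$ as a suffix, $\mathbb{P}(X_0=a\mid X_{-\infty}^{-1}=x_{-\infty}^{-1})=p(a|w)$ for all $a\in A$, and (2) no suffix of $w$ satisfies (1). An infinite context is a semi-infinite sequence none of whose finite suffixes $w_{-j}^{-1}$, $j=1,2,\dots$, is a context. The context tree $\mathcal{T}_0$ is the set of all finite and infinite contexts; for an i.i.d. process, $\mathcal{T}_0=\{\lambda\}$. Continuity quantities. $\alpha_0=\inf_{w\in\mathcal{T}_0,\,a\in A}p(a|w)$ and, for $k\ge1$, $\alpha_k=\inf_{u\in A^k}\sum_{a\in A}\inf_{w\in\mathcal{T}_0,\,w\succ u}p(a|w)$, where for a $u$ with no $w\in\mathcal{T}_0$, $w\succ u$, the sum over $a$ is read as $1$; $\mathbb{N}=\{0,1,2,\dots\}$ in $\alpha=\sum_{k\in\mathbb{N}}(1-\alpha_k)$. Estimator. Write $d=d(n)$. Given the sample $x_1^n$, for a sequence $w$ with $\ell(w)\le d$ and $a\in A$, $N_n(w,a)=\sum_{t=d+1}^n\mathbf{1}\{x_{t-\ell(w)}^{t-1}=w,\ x_t=a\}$ and $N_n(w)=\sum_{a\in A}N_n(w,a)$. A tree $\mathcal{T}$ is feasible if it is complete, $h(\mathcal{T})\le d$, $N_n(w)\ge1$ for all $w\in\mathcal{T}$, and any string $w'$ with $N_n(w')\ge1$ either belongs to $\mathcal{T}$, is a suffix of some $w\in\mathcal{T}$, or has a suffix that belongs to $\mathcal{T}$; $\mathcal{F}^d(x_1^n)$ is the set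 of feasible trees. Set $\hat p_n(a|w)=N_n(w,a)/N_n(w)$ and, for $\mathcal{T}\in\mathcal{F}^d(x_1^n)$, $\hat{\mathbb{P}}_{\mathrm{ML},\mathcal{T}}(x_1^n)=\prod_{w\in\mathcal{T}}\prod_{a\in A}\hat p_n(a|w)^{N_n(w,a)}$, with $0^0=1$. A penalizing term is a positive function $f(n)$ with $f(n)\to+\infty$ and $f(n)/n\to0$ as $n\to+\infty$. The penalized likelihood context tree estimator is a tree $$\hat{\mathcal{T}}(x_1^n)=\underset{\mathcal{T}\in\mathcal{F}^d(x_1^n)}{\arg\min}\{-\log\hat{\mathbb{P}}_{\mathrm{ML},\mathcal{T}}(x_1^n)+|\mathcal{T}|f(n)\}.$$
   Formalization: The alphabet A is assumed to have at least two symbols: for |A| = 1 all trees {a^j}, j ≤ d(n), are tied minimizers, so an arbitrary choice of the estimator violates the claim for K ≥ 1. *)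

theory Defs
  imports "HOL-Probability.Probability"
begin

section \<open>Sequences and trees\<close>

text \<open>
  Finite words are lists in chronological order. A semi-infinite sequence
  \<open>(\<dots>, v\<^sub>-\<^sub>2, v\<^sub>-\<^sub>1)\<close> is \<open>SemiInf v\<close> with \<open>v i\<close> the letter at time \<open>- i - 1\<close>,
  so that \<open>v 0\<close> is the most recent letter.
\<close>

datatype 'a seq = Fin "'a list" | SemiInf "nat \<Rightarrow> 'a"

fun len :: "'a seq \<Rightarrow> enat" where
  "len (Fin w) = enat (length w)"
| "len (SemiInf v) = \<infinity>"

fun conc :: "'a seq \<Rightarrow> 'a list \<Rightarrow> 'a seq" where
  "conc (Fin u) s = Fin (u @ s)"
| "conc (SemiInf v) s =
     SemiInf (\<lambda>i. if i < length s then rev s ! i else v (i - length s))"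

definition proper_suffix :: "'a seq \<Rightarrow> 'a seq \<Rightarrow> bool"  (infix "\<prec>" 50) where
  "s \<prec> w \<longleftrightarrow> (\<exists>u t. s = Fin t \<and> len u \<ge> 1 \<and> w = conc u t)"

definition suffix_eq :: "'a seq \<Rightarrow> 'a seq \<Rightarrow> bool"  (infix "\<preceq>" 50) where
  "s \<preceq> w \<longleftrightarrow> s \<prec> w \<or> s = w"

definition is_tree :: "'a seq set \<Rightarrow> bool" where
  "is_tree T \<longleftrightarrow> (\<forall>s\<in>T. \<forall>w\<in>T. \<not> s \<prec> w)"

definition height :: "'a seq set \<Rightarrow> enat" where
  "height T = (SUP w\<in>T. len w)"

definition truncation :: "'a seq set \<Rightarrow> nat \<Rightarrow> 'a seq set" where
  "truncation T K =
     {w \<in> T. len w \<le> enat K} \<union> {w. len w = enat K \<and> (\<exists>u\<in>T. w \<prec> u)}"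

definition complete_tree :: "'a seq set \<Rightarrow> bool" where
  "complete_tree T \<longleftrightarrow> (\<forall>v. \<exists>s\<in>T. s \<preceq> SemiInf v)"


section \<open>Stationary ergodic processes\<close>

text \<open>\<open>block X s t\<close> is the random word \<open>(X\<^sub>s, \<dots>, X\<^sub>t)\<close>, empty if \<open>t < s\<close>.\<close>

definition block :: "(int \<Rightarrow> 'w \<Rightarrow> 'a) \<Rightarrow> int \<Rightarrow> int \<Rightarrow> 'w \<Rightarrow> 'a list" where
  "block X s t \<omega> = map (\<lambda>i. X i \<omega>) [s..t]"

definition past :: "(int \<Rightarrow> 'w \<Rightarrow> 'a) \<Rightarrow> 'w \<Rightarrow> nat \<Rightarrow> 'a" where
  "past X \<omega> = (\<lambda>i. X (- int i - 1) \<omega>)"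

abbreviation path_space :: "('i \<Rightarrow> 'a) measure" where
  "path_space \<equiv> (\<Pi>\<^sub>M t\<in>UNIV. count_space UNIV)"

definition process_law :: "'w measure \<Rightarrow> (int \<Rightarrow> 'w \<Rightarrow> 'a) \<Rightarrow> (int \<Rightarrow> 'a) measure" where
  "process_law M X = distr M path_space (\<lambda>\<omega> t. X t \<omega>)"

definition shift :: "(int \<Rightarrow> 'a) \<Rightarrow> int \<Rightarrow> 'a" where
  "shift x = (\<lambda>t. x (t + 1))"

definition stationary :: "'w measure \<Rightarrow> (int \<Rightarrow> 'w \<Rightarrow> 'a) \<Rightarrow> bool" where
  "stationary M X \<longleftrightarrow> distr (process_law M X) path_space shift = process_law M X"

definition ergodic :: "'w measure \<Rightarrow> (int \<Rightarrow> 'w \<Rightarrow> 'a) \<Rightarrow> bool" where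
  "ergodic M X \<longleftrightarrow>
     (\<forall>B\<in>sets path_space. shift -` B = B \<longrightarrow> measure (process_law M X) B \<in> {0, 1})"

text \<open>
  \<open>q x\<close> is the conditional law of \<open>X\<^sub>0\<close> given that the whole past equals \<open>x\<close>. Such
  a kernel is determined only up to null sets of pasts, whereas contexts and the continuity
  quantities below refer to its value at every past; hence the version \<open>q\<close> is an explicit
  parameter throughout.
\<close>

definition cond_law_version ::
  "'w measure \<Rightarrow> (int \<Rightarrow> 'w \<Rightarrow> 'a::finite) \<Rightarrow> ((nat \<Rightarrow> 'a) \<Rightarrow> 'a pmf) \<Rightarrow> bool" where
  "cond_law_version M X q \<longleftrightarrow>
     (\<forall>a. (\<lambda>x. pmf (q x) a) \<in> borel_measurable path_space) \<and>
     (\<forall>a. AE \<omega> in M.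
        real_cond_exp M (vimage_algebra (space M) (past X) path_space)
          (indicator {\<omega> \<in> space M. X 0 \<omega> = a}) \<omega> = pmf (q (past X \<omega>)) a)"


section \<open>The context tree and the continuity quantities\<close>

definition word_prob :: "'w measure \<Rightarrow> (int \<Rightarrow> 'w \<Rightarrow> 'a) \<Rightarrow> 'a list \<Rightarrow> real" where
  "word_prob M X w = \<P>(\<omega> in M. block X 1 (int (length w)) \<omega> = w)"

fun trans_prob ::
  "'w measure \<Rightarrow> (int \<Rightarrow> 'w \<Rightarrow> 'a) \<Rightarrow> ((nat \<Rightarrow> 'a) \<Rightarrow> 'a pmf) \<Rightarrow> 'a \<Rightarrow> 'a seq \<Rightarrow> real" where
  "trans_prob M X q a (Fin w) =
     \<P>(\<omega> in M. X 0 \<omega> = a \<bar> block X (- int (length w)) (-1) \<omega> = w)"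
| "trans_prob M X q a (SemiInf x) = pmf (q x) a"

text \<open>
  The positivity requirement expresses that \<open>p(a|w)\<close> is only defined for words of
  positive probability.
\<close>

definition determines ::
  "'w measure \<Rightarrow> (int \<Rightarrow> 'w \<Rightarrow> 'a) \<Rightarrow> ((nat \<Rightarrow> 'a) \<Rightarrow> 'a pmf) \<Rightarrow> 'a list \<Rightarrow> bool" where
  "determines M X q w \<longleftrightarrow> word_prob M X w > 0 \<and>
     (\<forall>x. Fin w \<prec> SemiInf x \<longrightarrow>
        (\<forall>a. trans_prob M X q a (SemiInf x) = trans_prob M X q a (Fin w)))"

definition finite_context ::
  "'w measure \<Rightarrow> (int \<Rightarrow> 'w \<Rightarrow> 'a) \<Rightarrow> ((nat \<Rightarrow> 'a) \<Rightarrow> 'a pmf) \<Rightarrow> 'a list \<Rightarrow> bool" where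
  "finite_context M X q w \<longleftrightarrow> determines M X q w \<and>
     \<not> (\<exists>s. Fin s \<prec> Fin w \<and> determines M X q s)"

text \<open>
  The empty word counts among the finite suffixes of a semi-infinite sequence; this is
  what makes the context tree of an i.i.d. process equal to \<open>{Fin []}\<close>.
\<close>

definition infinite_context ::
  "'w measure \<Rightarrow> (int \<Rightarrow> 'w \<Rightarrow> 'a) \<Rightarrow> ((nat \<Rightarrow> 'a) \<Rightarrow> 'a pmf) \<Rightarrow> (nat \<Rightarrow> 'a) \<Rightarrow> bool" where
  "infinite_context M X q x \<longleftrightarrow> \<not> (\<exists>s. Fin s \<prec> SemiInf x \<and> finite_context M X q s)"

definition context_tree ::
  "'w measure \<Rightarrow> (int \<Rightarrow> 'w \<Rightarrow> 'a) \<Rightarrow> ((nat \<Rightarrow> 'a) \<Rightarrow> 'a pmf) \<Rightarrow> 'a seq set" where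
  "context_tree M X q =
     {Fin w |w. finite_context M X q w} \<union> {SemiInf x |x. infinite_context M X q x}"

definition cont_coeff ::
  "'w measure \<Rightarrow> (int \<Rightarrow> 'w \<Rightarrow> 'a::finite) \<Rightarrow> ((nat \<Rightarrow> 'a) \<Rightarrow> 'a pmf) \<Rightarrow> nat \<Rightarrow> real" where
  "cont_coeff M X q k =
     (if k = 0 then (INF (w, a) \<in> context_tree M X q \<times> UNIV. trans_prob M X q a w)
      else (INF u \<in> {u. length u = k}.
        if \<exists>w\<in>context_tree M X q. Fin u \<prec> w
        then (\<Sum>a\<in>UNIV. INF w \<in> {w \<in> context_tree M X q. Fin u \<prec> w}. trans_prob M X q a w)
        else 1))"


section \<open>The penalized likelihood context tree estimator\<close>

text \<open>A sample \<open>x\<^sub>1, \<dots>, x\<^sub>n\<close> is a list \<open>xs\<close> of length \<open>n\<close>, with \<open>x\<^sub>t = xs ! (t - 1)\<close>.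
  The counts are meaningful for words of length at most \<open>d\<close>.\<close>

definition letter_count :: "nat \<Rightarrow> 'a list \<Rightarrow> 'a list \<Rightarrow> 'a \<Rightarrow> nat" where
  "letter_count d xs w a =
     (\<Sum>t = d + 1..length xs.
        of_bool (map (\<lambda>i. xs ! (i - 1)) [t - length w..<t] = w \<and> xs ! (t - 1) = a))"

definition word_count :: "nat \<Rightarrow> 'a::finite list \<Rightarrow> 'a list \<Rightarrow> nat" where
  "word_count d xs w = (\<Sum>a\<in>UNIV. letter_count d xs w a)"

definition feasible_trees :: "nat \<Rightarrow> 'a::finite list \<Rightarrow> 'a seq set set" where
  "feasible_trees d xs =
     {T. is_tree T \<and> complete_tree T \<and> height T \<le> enat d \<and>
         (\<forall>w. Fin w \<in> T \<longrightarrow> word_count d xs w \<ge> 1) \<and>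
         (\<forall>w'. length w' \<le> d \<and> word_count d xs w' \<ge> 1 \<longrightarrow>
            Fin w' \<in> T \<or> (\<exists>w\<in>T. Fin w' \<prec> w) \<or> (\<exists>s\<in>T. s \<prec> Fin w'))}"

definition emp_prob :: "nat \<Rightarrow> 'a::finite list \<Rightarrow> 'a \<Rightarrow> 'a list \<Rightarrow> real" where
  "emp_prob d xs a w = real (letter_count d xs w a) / real (word_count d xs w)"

definition ml_prob :: "nat \<Rightarrow> 'a::finite list \<Rightarrow> 'a seq set \<Rightarrow> real" where
  "ml_prob d xs T = (\<Prod>w\<in>{w. Fin w \<in> T}. \<Prod>a\<in>UNIV. emp_prob d xs a w ^ letter_count d xs w a)"

definition penalizing_term :: "(nat \<Rightarrow> real) \<Rightarrow> bool" where
  "penalizing_term f \<longleftrightarrow>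
     (\<forall>n. f n > 0) \<and> filterlim f at_top sequentially \<and> (\<lambda>n. f n / real n) \<longlonglongrightarrow> 0"

text \<open>The minimizer need not be unique; any selection of a minimizer is an estimator.\<close>

definition pl_estimator ::
  "(nat \<Rightarrow> real) \<Rightarrow> (nat \<Rightarrow> nat) \<Rightarrow> ('a::finite list \<Rightarrow> 'a seq set) \<Rightarrow> bool" where
  "pl_estimator f d That \<longleftrightarrow>
     (\<forall>xs. xs \<noteq> [] \<longrightarrow>
        is_arg_min
          (\<lambda>T. - ln (ml_prob (d (length xs)) xs T) + real (card T) * f (length xs))
          (\<lambda>T. T \<in> feasible_trees (d (length xs)) xs)
          (That xs))"

end

theory Submission
  imports Defs "HOL-Library.Sublist"
begin

text \<open>
  A complete tree is determined up to level \<open>K\<close> by its internal nodes of length less than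
  \<open>K\<close>, so it suffices that almost surely, for large samples, the estimated tree and the
  context tree have the same short internal nodes. Let \<open>\<alpha>\<close> be \<open>\<alpha>\<^sub>0\<close>. Three facts about the
  process carry the proof. The kernel \<open>q\<close> is bounded below by \<open>\<alpha>\<close> at every past. The convergence
  \<open>\<alpha>\<^sub>k \<rightarrow> 1\<close>, a consequence of summability, is uniform continuity of \<open>q\<close>
  (\<open>kernel_continuity\<close>). Finally, a word is internal in the context tree iff \<open>q\<close> is not
  constant on the pasts that end in it (\<open>internal_context_tree_iff\<close>).

  All randomness is confined to one event, \<open>typical\<close>. Every word \<open>v\<close> up to the maximal height
  occurs at least of the order of \<open>n \<alpha>\<^bsup>\<bar>v\<bar>\<^esup> / (\<bar>v\<bar> + 1)\<close> times. Among its occurrences, the number of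
  those followed by \<open>a\<close> stays, up to an additive error \<open>B\<close>, between the multiples of their total
  number by the extremes of the probability of \<open>a\<close> under \<open>q\<close> on the pasts ending in \<open>v\<close>. Both bounds are Chernoff estimates on the finite words \<open>x\<^sub>1\<dots>x\<^sub>n\<close>: for the counts because in
  each successive block the word appears with conditional probability at least
  \<open>\<alpha>\<^bsup>\<bar>v\<bar>\<^esup>\<close> (\<open>occ_deviation\<close>), and for the letters because the compensated counts are
  supermartingales with bounded increments (\<open>drift_deviation\<close>). With \<open>B\<^sup>2\<close> proportional to
  \<open>f(n) n \<alpha>\<^bsup>d\<^esup> / d\<close>, a union bound over all words of length at most \<open>d\<close> gives a failure
  probability of order \<open>\<bar>A\<bar>\<^bsup>d\<^esup> exp (- f(n) c\<^bsup>d\<^esup> / d)\<close> (\<open>pr_not_typical_penalty\<close>). This is the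
  summable expression of the theorem, so Borel-Cantelli applies.

  On typical samples the argument is deterministic and compares the optimal tree with
  a graft, that is, with the tree obtained by replacing everything below one node (\<open>cost_graft\<close>).
  If the optimal tree branched below a word \<open>s\<close> on which \<open>q\<close> is constant, pruning at \<open>s\<close> would
  lose less than half a penalty per leaf in likelihood and save at least half
  (\<open>no_overestimation\<close>). If it had a leaf \<open>w\<close> on which \<open>q\<close> is not constant, growing the
  full subtree of a fixed depth below \<open>w\<close> would gain likelihood linear in \<open>n\<close>, at the price of
  boundedly many penalties \<open>f(n) = o(n)\<close> (\<open>no_underestimation\<close>).
\<close>

section \<open>Suffixes, trees and grafting\<close>

definition recent :: "(nat \<Rightarrow> 'a) \<Rightarrow> nat \<Rightarrow> 'a list" where
  "recent x k = rev (map x [0..<k])"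

definition cylinder :: "'a list \<Rightarrow> (nat \<Rightarrow> 'a) set" where
  "cylinder s = {x. recent x (length s) = s}"

lemma length_recent [simp]: "length (recent x k) = k"
  by (simp add: recent_def)

lemma suffix_recent: "j \<le> k \<Longrightarrow> suffix (recent x j) (recent x k)"
proof -
  assume "j \<le> k"
  then have "[0..<k] = [0..<j] @ [j..<k]"
    by (metis le0 le_add_diff_inverse upt_add_eq_append)
  then show ?thesis by (auto simp: recent_def suffix_def)
qed

lemma recent_in_cylinder [simp]: "x \<in> cylinder (recent x k)"
  by (simp add: cylinder_def)

lemma suffix_same_length: "suffix s w \<Longrightarrow> suffix t w \<Longrightarrow> length s = length t \<Longrightarrow> s = t"
  by (metis suffix_length_suffix suffix_order.antisym order_refl)

lemma cylinder_mono: "suffix s w \<Longrightarrow> x \<in> cylinder w \<Longrightarrow> x \<in> cylinder s"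
  unfolding cylinder_def
  by (metis (mono_tags, lifting) length_recent mem_Collect_eq suffix_length_le suffix_recent
      suffix_same_length)

lemma cylinder_comparable:
  "x \<in> cylinder s \<Longrightarrow> x \<in> cylinder t \<Longrightarrow> length s \<le> length t \<Longrightarrow> suffix s t"
  unfolding cylinder_def by (metis (mono_tags, lifting) mem_Collect_eq suffix_recent)

lemma prec_Fin_Fin [simp]: "Fin s \<prec> Fin w \<longleftrightarrow> strict_suffix s w"
proof
  assume "Fin s \<prec> Fin w"
  then obtain u where "len u \<ge> 1" "Fin w = conc u s" by (auto simp: proper_suffix_def)
  then show "strict_suffix s w"
    by (cases u) (auto simp: strict_suffix_def suffix_def one_enat_def)
next
  assume "strict_suffix s w"
  then obtain u where u: "w = u @ s" "u \<noteq> []"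
    by (auto simp: strict_suffix_def suffix_def)
  then have "len (Fin u) \<ge> 1" by (simp add: one_enat_def Suc_le_eq)
  with u show "Fin s \<prec> Fin w" unfolding proper_suffix_def
    by (intro exI[of _ "Fin u"] exI[of _ s]) simp
qed

lemma prec_Fin_SemiInf [simp]: "Fin s \<prec> SemiInf x \<longleftrightarrow> x \<in> cylinder s"
proof
  assume "Fin s \<prec> SemiInf x"
  then obtain u where "SemiInf x = conc u s" by (auto simp: proper_suffix_def)
  then obtain v where "x = (\<lambda>i. if i < length s then rev s ! i else v (i - length s))"
    by (cases u) auto
  then have "map x [0..<length s] = map (\<lambda>i. rev s ! i) [0..<length (rev s)]" by simp
  also have "\<dots> = rev s" by (rule map_nth)
  finally show "x \<in> cylinder s" by (simp add: cylinder_def recent_def)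
next
  assume "x \<in> cylinder s"
  then have "rev s = map x [0..<length s]" by (metis (mono_tags) cylinder_def mem_Collect_eq recent_def rev_rev_ident)
  then have "SemiInf x = conc (SemiInf (\<lambda>i. x (i + length s))) s"
    by (auto simp: fun_eq_iff)
  then show "Fin s \<prec> SemiInf x" unfolding proper_suffix_def
    by (intro exI[of _ "SemiInf (\<lambda>i. x (i + length s))"] exI[of _ s]) simp
qed

lemma prec_imp_Fin: "u \<prec> w \<Longrightarrow> \<exists>s. u = Fin s"
  by (auto simp: proper_suffix_def)

lemma prec_trans: "suffix s t \<Longrightarrow> Fin t \<prec> u \<Longrightarrow> Fin s \<prec> u"
  by (cases u) (auto simp: suffix_order.dual_order.strict_trans1 intro: cylinder_mono
    suffix_order.le_less_trans)

lemma prec_comparable: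
  "Fin s \<prec> u \<Longrightarrow> Fin t \<prec> u \<Longrightarrow> suffix s t \<or> strict_suffix t s"
proof (cases u)
  case (Fin w)
  assume "Fin s \<prec> u" "Fin t \<prec> u"
  then have "suffix s w" "suffix t w" using Fin by auto
  then show ?thesis by (metis suffix_order.order_iff_strict suffix_same_cases)
next
  case (SemiInf x)
  assume "Fin s \<prec> u" "Fin t \<prec> u"
  then show ?thesis using SemiInf
    by (metis cylinder_comparable nle_le prec_Fin_SemiInf suffix_order.le_less)
qed

lemma cylinder_nonempty: "\<exists>x. x \<in> cylinder s"
proof -
  have "Fin s \<prec> conc (SemiInf (\<lambda>_. undefined)) s"
    unfolding proper_suffix_def
    by (intro exI[of _ "SemiInf (\<lambda>_. undefined)"] exI[of _ s]) simp
  then show ?thesis by (auto simp del: prec_Fin_SemiInf simp: prec_Fin_SemiInf[symmetric])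
qed

definition internal :: "'a seq set \<Rightarrow> 'a list \<Rightarrow> bool" where
  "internal T s \<longleftrightarrow> (\<exists>u\<in>T. Fin s \<prec> u)"

lemma internal_suffix: "internal T t \<Longrightarrow> suffix s t \<Longrightarrow> internal T s"
  unfolding internal_def using prec_trans by blast

text \<open>Extend \<open>s\<close> to a past: completeness supplies a leaf that is a suffix of it, and any two
  suffixes of one past are comparable.\<close>

lemma internal_or_leaf_suffix:
  assumes "complete_tree T"
  shows "internal T s \<or> (\<exists>t. suffix t s \<and> Fin t \<in> T)"
proof -
  obtain x where x: "x \<in> cylinder s" using cylinder_nonempty by blast
  obtain u where u: "u \<in> T" "u \<preceq> SemiInf x" using assms unfolding complete_tree_def by blast
  show ?thesis
  proof (cases "u = SemiInf x")
    case True
    then have "Fin s \<prec> u" using x by simp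
    then show ?thesis using u(1) unfolding internal_def by blast
  next
    case False
    then obtain t where t: "u = Fin t" "x \<in> cylinder t"
      using u by (metis prec_Fin_SemiInf prec_imp_Fin suffix_eq_def)
    from prec_comparable[of s "SemiInf x" t] t x have "suffix t s \<or> strict_suffix s t"
      using suffix_order.le_less by auto
    moreover have "internal T s" if "strict_suffix s t"
      using that t u unfolding internal_def by (intro bexI[of _ u]) auto
    ultimately show ?thesis using t u by blast
  qed
qed

lemma leaf_suffix_not_internal:
  "is_tree T \<Longrightarrow> Fin t \<in> T \<Longrightarrow> suffix t s \<Longrightarrow> \<not> internal T s"
  unfolding internal_def is_tree_def using prec_trans by blast

text \<open>For complete trees the set of internal nodes thus encodes the whole tree; it is easier to
  compare than the tree itself because it is closed under suffixes.\<close>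

lemma leaf_iff_internal:
  assumes "is_tree T" "complete_tree T"
  shows "Fin w \<in> T \<longleftrightarrow> \<not> internal T w \<and> (\<forall>s. strict_suffix s w \<longrightarrow> internal T s)"
  using assms internal_or_leaf_suffix[of T w] leaf_suffix_not_internal[of T]
  by (metis internal_def prec_Fin_Fin suffix_order.le_less)

text \<open>At level \<open>K\<close> the truncation does not record whether a node is a leaf, so only nodes shorter
  than \<open>K\<close> are tested for being internal.\<close>

lemma truncation_by_internal:
  assumes "is_tree T" "complete_tree T"
  shows "truncation T K = {Fin w |w. length w \<le> K \<and> (\<forall>s. strict_suffix s w \<longrightarrow> internal T s)
           \<and> (length w < K \<longrightarrow> \<not> internal T w)}"
proof (intro set_eqI)
  fix u
  show "u \<in> truncation T K \<longleftrightarrow> u \<in> {Fin w |w. length w \<le> K \<and>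
      (\<forall>s. strict_suffix s w \<longrightarrow> internal T s) \<and> (length w < K \<longrightarrow> \<not> internal T w)}"
  proof (cases u)
    case (Fin w)
    have "u \<in> truncation T K \<longleftrightarrow>
        length w \<le> K \<and> (Fin w \<in> T \<or> length w = K \<and> internal T w)"
      by (auto simp: truncation_def Fin internal_def)
    then show ?thesis
      using leaf_iff_internal[OF assms, of w] internal_suffix[of T w] Fin
      by (auto simp: strict_suffix_def)
  qed (auto simp: truncation_def)
qed

lemma truncation_eqI:
  assumes "is_tree T" "complete_tree T" "is_tree T'" "complete_tree T'"
    and eq: "\<And>s. length s < K \<Longrightarrow> internal T s \<longleftrightarrow> internal T' s"
  shows "truncation T K = truncation T' K"
proof -
  have "length s < K" if "strict_suffix s w" "length w \<le> K" for s w :: "'a list"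
    using that by (metis suffix_length_less less_le_trans)
  then show ?thesis
    unfolding truncation_by_internal[OF assms(1,2)] truncation_by_internal[OF assms(3,4)]
    using eq by (intro Collect_cong) blast
qed

text \<open>Pruning a tree at \<open>s\<close> is grafting \<open>{s}\<close>; growing a leaf \<open>s\<close> is grafting all words of a
  given length that end in \<open>s\<close>.\<close>

definition graft :: "'a seq set \<Rightarrow> 'a list \<Rightarrow> 'a list set \<Rightarrow> 'a seq set" where
  "graft T s S = {t \<in> T. \<not> Fin s \<preceq> t} \<union> Fin ` S"

text \<open>The analogue of a complete tree for the pasts that end in \<open>s\<close>.\<close>

definition subtree_at :: "'a list \<Rightarrow> 'a list set \<Rightarrow> bool" where
  "subtree_at s S \<longleftrightarrow> (\<forall>v\<in>S. suffix s v) \<and> (\<forall>u\<in>S. \<forall>v\<in>S. \<not> strict_suffix u v) \<and>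
     (\<forall>x\<in>cylinder s. \<exists>v\<in>S. x \<in> cylinder v)"

lemma preceq_Fin_Fin [simp]: "Fin s \<preceq> Fin t \<longleftrightarrow> suffix s t"
  by (auto simp: suffix_eq_def)

lemma preceq_Fin_SemiInf [simp]: "Fin s \<preceq> SemiInf x \<longleftrightarrow> x \<in> cylinder s"
  by (auto simp: suffix_eq_def)

text \<open>A retained leaf cannot be a suffix of a new one: it would be comparable with \<open>s\<close>, hence a
  proper suffix of \<open>s\<close> and of the old leaf above \<open>s\<close>.\<close>

lemma is_tree_graft:
  assumes T: "is_tree T" and s: "Fin s \<in> T \<or> internal T s" and S: "subtree_at s S"
  shows "is_tree (graft T s S)"
proof -
  obtain u where u: "u \<in> T" "Fin s \<preceq> u"
    using s by (auto simp: internal_def suffix_eq_def)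
  have aux: "False" if "t \<in> T" "\<not> Fin s \<preceq> t" "v \<in> S" "t \<prec> Fin v \<or> Fin v \<prec> t" for t v
  proof -
    have sv: "suffix s v" using S that by (auto simp: subtree_at_def)
    show False
    proof (cases "t \<prec> Fin v")
      case True
      then obtain t' where t': "t = Fin t'" using prec_imp_Fin by blast
      then have "strict_suffix t' s"
        using that True sv by (metis preceq_Fin_Fin prec_Fin_Fin strict_suffix_def suffix_same_cases suffix_order.order_refl)
      then have "t \<prec> u" using u(2) t' prec_trans[of t' s u]
        by (metis prec_Fin_Fin strict_suffix_def suffix_eq_def)
      then show False using T u that by (auto simp: is_tree_def)
    next
      case False
      then have "Fin v \<prec> t" using that by blast
      then show False using that(2) sv prec_trans by (auto simp: suffix_eq_def)
    qed
  qed
  show ?thesis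
    unfolding is_tree_def
  proof (intro ballI)
    fix t v assume "t \<in> graft T s S" "v \<in> graft T s S"
    then consider "t \<in> T" "v \<in> T" | t' where "t = Fin t'" "t' \<in> S" "v \<in> T" "\<not> Fin s \<preceq> v"
      | v' where "v = Fin v'" "v' \<in> S" "t \<in> T" "\<not> Fin s \<preceq> t"
      | t' v' where "t = Fin t'" "t' \<in> S" "v = Fin v'" "v' \<in> S"
      unfolding graft_def by blast
    then show "\<not> t \<prec> v"
    proof cases
      case 1 then show ?thesis using T by (simp add: is_tree_def)
    next
      case 2 then show ?thesis using aux by blast
    next
      case 3 then show ?thesis using aux by blast
    next
      case 4 then show ?thesis using S by (simp add: subtree_at_def)
    qed
  qed
qed

lemma complete_tree_graft:
  assumes T: "complete_tree T" and S: "subtree_at s S"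
  shows "complete_tree (graft T s S)"
  unfolding complete_tree_def
proof
  fix x
  obtain t where t: "t \<in> T" "t \<preceq> SemiInf x" using T by (auto simp: complete_tree_def)
  show "\<exists>t\<in>graft T s S. t \<preceq> SemiInf x"
  proof (cases "Fin s \<preceq> t")
    case False
    then show ?thesis using t by (auto simp: graft_def)
  next
    case True
    then have "x \<in> cylinder s" using t
      by (metis prec_Fin_SemiInf prec_imp_Fin preceq_Fin_Fin preceq_Fin_SemiInf suffix_eq_def cylinder_mono)
    then obtain v where "v \<in> S" "x \<in> cylinder v" using S by (auto simp: subtree_at_def)
    then show ?thesis by (intro bexI[of _ "Fin v"]) (auto simp: graft_def)
  qed
qed

lemma subtree_at_singleton: "subtree_at s {s}"
  by (auto simp: subtree_at_def)

lemma subtree_at_level: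
  assumes "length s \<le> k"
  shows "subtree_at s {v. length v = k \<and> suffix s v}"
  unfolding subtree_at_def
proof (intro conjI ballI)
  fix x assume x: "x \<in> cylinder s"
  have "suffix s (recent x k)"
    using cylinder_comparable[OF x, of "recent x k"] assms by simp
  then show "\<exists>v\<in>{v. length v = k \<and> suffix s v}. x \<in> cylinder v"
    by (intro bexI[of _ "recent x k"]) auto
next
  fix u v assume "u \<in> {v. length v = k \<and> suffix s v}" "v \<in> {v. length v = k \<and> suffix s v}"
  then show "\<not> strict_suffix u v" by (auto simp: strict_suffix_def suffix_def)
qed auto

lemma subtree_at_below:
  assumes "is_tree T" "complete_tree T" "Fin s \<in> T \<or> internal T s" "\<And>x. SemiInf x \<notin> T"
  shows "subtree_at s {v. Fin v \<in> T \<and> suffix s v}"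
  unfolding subtree_at_def
proof (intro conjI ballI)
  fix x assume x: "x \<in> cylinder s"
  obtain t where t: "t \<in> T" "t \<preceq> SemiInf x" using assms(2) by (auto simp: complete_tree_def)
  then obtain v where v: "t = Fin v" "x \<in> cylinder v" using assms(4) by (cases t) auto
  have "\<not> strict_suffix v s"
  proof
    assume vs: "strict_suffix v s"
    then have "\<not> internal T s"
      using t v leaf_suffix_not_internal[OF assms(1), of v s] by auto
    then have "Fin s \<in> T" using assms(3) by blast
    moreover have "Fin v \<prec> Fin s" using vs by simp
    ultimately show False using assms(1) t v unfolding is_tree_def by blast
  qed
  then have "suffix s v"
    using cylinder_comparable[OF x v(2)] cylinder_comparable[OF v(2) x] 
    by (metis nle_le strict_suffix_def suffix_order.order_refl)
  then show "\<exists>v\<in>{v. Fin v \<in> T \<and> suffix s v}. x \<in> cylinder v" using v t by blast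
next
  fix u v assume "u \<in> {v. Fin v \<in> T \<and> suffix s v}" "v \<in> {v. Fin v \<in> T \<and> suffix s v}"
  then have "\<not> Fin u \<prec> Fin v" using assms(1) unfolding is_tree_def by blast
  then show "\<not> strict_suffix u v" by simp
qed auto

text \<open>Two distinct letters in front of \<open>s\<close> lead to distinct leaves. Pruning therefore saves at
  least one penalty.\<close>

lemma internal_two_leaves:
  assumes "is_tree T" "complete_tree T" "internal T s" "\<And>x. SemiInf x \<notin> T"
    and "finite {v. Fin v \<in> T \<and> suffix s v}" and "CARD('a::finite) \<ge> 2"
  shows "card {v::'a list. Fin v \<in> T \<and> suffix s v} \<ge> 2"
proof -
  let ?S = "{v. Fin v \<in> T \<and> suffix s v}"
  have *: "\<exists>v\<in>?S. suffix (b # s) v" for b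
  proof -
    obtain x where x: "x \<in> cylinder (b # s)" using cylinder_nonempty by blast
    then have "x \<in> cylinder s" using cylinder_mono[of s "b # s"] by (simp add: suffix_ConsI)
    then obtain v where v: "v \<in> ?S" "x \<in> cylinder v"
      using subtree_at_below[OF assms(1,2) _ assms(4), of s] assms(3) by (auto simp: subtree_at_def)
    have "v \<noteq> s" using v(1) leaf_suffix_not_internal[OF assms(1), of s s] assms(3) by auto
    then have "length v > length s" using v(1) by (auto simp: suffix_def)
    then have "suffix (b # s) v" using cylinder_comparable[OF x v(2)] by simp
    then show ?thesis using v by blast
  qed
  obtain b c :: 'a where bc: "b \<noteq> c"
    using assms(6) by (metis (full_types) card_2_iff' ex_card UNIV_I subsetI obtain_subset_with_card_n)
  obtain u where u: "u \<in> ?S" "suffix (b # s) u" using * by blast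
  obtain v where v: "v \<in> ?S" "suffix (c # s) v" using * by blast
  have "u \<noteq> v" using u v bc suffix_same_length[of "b # s" u "c # s"] by auto
  then have "card {u, v} \<le> card ?S" using u v assms(5) by (intro card_mono) auto
  with \<open>u \<noteq> v\<close> show ?thesis by simp
qed

section \<open>Empirical counts and the penalized likelihood\<close>

text \<open>With \<open>t = j + 1\<close>, the one-based position \<open>t\<close> of the sample holds the letter with zero-based
  index \<open>j\<close>, and its history is \<open>take j xs\<close>.\<close>

lemma count_condition_suffix:
  assumes "length w \<le> d" "d \<le> j" "j < length xs"
  shows "map (\<lambda>i. xs ! (i - 1)) [Suc j - length w..<Suc j] = w \<longleftrightarrow> suffix w (take j xs)"
proof -
  have "[Suc j - length w..<Suc j] = map Suc [j - length w..<j]"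
    using assms by (simp add: map_Suc_upt Suc_diff_le del: upt_Suc)
  then have "map (\<lambda>i. xs ! (i - 1)) [Suc j - length w..<Suc j] = map ((!) xs) [j - length w..<j]"
    by (simp add: comp_def del: upt_Suc)
  also have "\<dots> = drop (j - length w) (take j xs)"
    using assms by (intro nth_equalityI) auto
  finally have "map (\<lambda>i. xs ! (i - 1)) [Suc j - length w..<Suc j] = drop (j - length w) (take j xs)" .
  moreover have "suffix w (take j xs) \<longleftrightarrow> drop (j - length w) (take j xs) = w"
  proof
    assume "suffix w (take j xs)"
    then obtain z where z: "take j xs = z @ w" by (auto simp: suffix_def)
    moreover from this have "j - length w = length z"
      using assms by (metis add_diff_cancel_right' length_append length_take min.absorb2 less_imp_le)
    ultimately show "drop (j - length w) (take j xs) = w" by simp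
  qed (metis suffix_drop)
  ultimately show ?thesis by simp
qed

lemma letter_count_eq:
  assumes "length w \<le> d"
  shows "letter_count d xs w a =
           (\<Sum>j = d..<length xs. of_bool (suffix w (take j xs) \<and> xs ! j = a))"
proof -
  have "letter_count d xs w a = (\<Sum>t \<in> Suc ` {d..<length xs}.
        of_bool (map (\<lambda>i. xs ! (i - 1)) [t - length w..<t] = w \<and> xs ! (t - 1) = a))"
    unfolding letter_count_def by (intro sum.cong) (auto simp: image_Suc_atLeastLessThan atLeastLessThanSuc_atLeastAtMost)
  also have "\<dots> = (\<Sum>j = d..<length xs. of_bool (suffix w (take j xs) \<and> xs ! j = a))"
    using count_condition_suffix[OF assms]
    by (subst sum.reindex) (auto intro!: sum.cong simp del: upt_Suc)
  finally show ?thesis .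
qed

lemma word_count_eq:
  assumes "length (w::'a::finite list) \<le> d"
  shows "word_count d xs w = (\<Sum>j = d..<length xs. of_bool (suffix w (take j xs)))"
proof -
  have "(\<Sum>a\<in>UNIV. of_bool (P \<and> y = a)) = (of_bool P :: nat)" for P and y :: 'a
    by (cases P) (simp_all add: of_bool_def sum.delta)
  then show ?thesis
    unfolding word_count_def letter_count_eq[OF assms] by (subst sum.swap) simp
qed

text \<open>Counting starts only at histories of length \<open>d\<close>, so a history that ends in \<open>s\<close> is long
  enough to end in exactly one leaf of the subtree.\<close>

lemma letter_count_subtree:
  assumes S: "subtree_at s S" "finite S" and le: "\<And>v. v \<in> S \<Longrightarrow> length v \<le> d" "length s \<le> d"
  shows "letter_count d xs s a = (\<Sum>v\<in>S. letter_count d xs v a)"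
proof -
  have *: "of_bool (suffix s h \<and> P) = (\<Sum>v\<in>S. of_bool (suffix v h \<and> P) :: nat)"
    if h: "d \<le> length h" for h P
  proof (cases "suffix s h \<and> P")
    case True
    obtain x where x: "x \<in> cylinder h" using cylinder_nonempty by blast
    then have "x \<in> cylinder s" using True cylinder_mono by blast
    then obtain v where v: "v \<in> S" "x \<in> cylinder v" using S by (auto simp: subtree_at_def)
    have vh: "suffix v h" using cylinder_comparable[OF v(2) x] le(1)[OF v(1)] h by simp
    have uniq: "suffix u h \<longleftrightarrow> u = v" if "u \<in> S" for u
    proof
      assume "suffix u h"
      then have "suffix u v \<or> suffix v u" using vh suffix_same_cases by blast
      then show "u = v" using S that v(1) by (auto simp: subtree_at_def strict_suffix_def)
    qed (use vh in simp)
    have "(\<Sum>u\<in>S. of_bool (suffix u h \<and> P) :: nat) = (\<Sum>u\<in>S. if u = v then 1 else 0)"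
      using uniq True by (intro sum.cong) auto
    then show ?thesis using v True S(2) by (simp add: sum.delta')
  next
    case False
    have "\<not> (suffix v h \<and> P)" if "v \<in> S" for v
      using False S that suffix_order.trans unfolding subtree_at_def by blast
    then have "(\<Sum>v\<in>S. of_bool (suffix v h \<and> P) :: nat) = (\<Sum>v\<in>S. 0)"
      by (intro sum.cong) auto
    then show ?thesis using False by (simp only: sum.neutral_const of_bool_eq)
  qed
  have "letter_count d xs s a = (\<Sum>j = d..<length xs. \<Sum>v\<in>S. of_bool (suffix v (take j xs) \<and> xs ! j = a))"
    unfolding letter_count_eq[OF le(2)] by (intro sum.cong * refl) auto
  also have "\<dots> = (\<Sum>v\<in>S. letter_count d xs v a)"
    by (subst sum.swap) (simp add: letter_count_eq le)
  finally show ?thesis .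
qed

definition kl_div :: "('a::finite \<Rightarrow> real) \<Rightarrow> ('a \<Rightarrow> real) \<Rightarrow> real" where
  "kl_div p r = (\<Sum>a\<in>UNIV. p a * (ln (p a) - ln (r a)))"

text \<open>A substitute for Pinsker's inequality. The divergence dominates the squared Hellinger
  distance \<open>\<Sum>\<^sub>a (\<surd>p\<^sub>a - \<surd>r\<^sub>a)\<^sup>2\<close>, and the map \<open>x \<mapsto> x\<^sup>2\<close> is \<open>2\<close>-Lipschitz on \<open>[0, 1]\<close>.\<close>

lemma kl_div_ge:
  assumes "\<And>a. p a \<ge> 0" "\<And>a. r a \<ge> 0" "sum p UNIV = 1" "sum r UNIV = 1"
    and ac: "\<And>a. p a > 0 \<Longrightarrow> r a > 0"
  shows "(p b - r b)\<^sup>2 / 4 \<le> kl_div p r"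
proof -
  have pt: "2 * p a - 2 * sqrt (p a * r a) \<le> p a * (ln (p a) - ln (r a))" for a
  proof (cases "p a = 0")
    case False
    then have pos: "p a > 0" "r a > 0" using assms(1)[of a] ac[of a] by auto
    \<comment> \<open>Using \<open>ln x \<le> x - 1\<close> at the square root of the ratio, instead of at the ratio itself,
      is what leaves the Hellinger distance behind.\<close>
    have "ln (sqrt (r a / p a)) \<le> sqrt (r a / p a) - 1"
      using pos by (intro ln_le_minus_one) simp
    then have "ln (r a) - ln (p a) \<le> 2 * (sqrt (r a / p a) - 1)"
      using pos by (simp add: ln_sqrt ln_div)
    then have "p a * (ln (r a) - ln (p a)) \<le> p a * (2 * (sqrt (r a / p a) - 1))"
      using pos by (intro mult_left_mono) auto
    moreover have "p a * sqrt (r a / p a) = sqrt (p a * r a)"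
      using pos by (simp add: real_sqrt_divide real_sqrt_mult field_simps)
    ultimately show ?thesis by (simp add: algebra_simps)
  qed simp
  have bound: "\<bar>sqrt (p b) + sqrt (r b)\<bar> \<le> 2"
  proof -
    have "p b \<le> 1" using member_le_sum[of b UNIV p] assms by auto
    moreover have "r b \<le> 1" using member_le_sum[of b UNIV r] assms by auto
    ultimately have "sqrt (p b) \<le> 1" "sqrt (r b) \<le> 1" by auto
    then show ?thesis using assms(1,2)[of b] by (smt (verit) real_sqrt_ge_zero)
  qed
  have "(p b - r b)\<^sup>2 = (sqrt (p b) - sqrt (r b))\<^sup>2 * (sqrt (p b) + sqrt (r b))\<^sup>2"
    using assms(1,2)[of b] by (simp add: power_mult_distrib[symmetric] algebra_simps)
  also have "\<dots> \<le> (sqrt (p b) - sqrt (r b))\<^sup>2 * 2\<^sup>2"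
    using bound by (intro mult_left_mono power2_le_iff_abs_le[THEN iffD2]) auto
  finally have "(p b - r b)\<^sup>2 / 4 \<le> (sqrt (p b) - sqrt (r b))\<^sup>2" by simp
  also have "\<dots> \<le> (\<Sum>a\<in>UNIV. (sqrt (p a) - sqrt (r a))\<^sup>2)"
    by (intro member_le_sum) auto
  also have "\<dots> = (\<Sum>a\<in>UNIV. p a + r a - 2 * sqrt (p a * r a))"
    using assms(1,2) by (intro sum.cong) (auto simp: power2_diff real_sqrt_mult)
  also have "\<dots> = (\<Sum>a\<in>UNIV. 2 * p a - 2 * sqrt (p a * r a))"
    using assms(3,4) by (simp add: sum.distrib sum_subtractf flip: sum_distrib_left)
  also have "\<dots> \<le> kl_div p r"
    unfolding kl_div_def by (intro sum_mono pt)
  finally show ?thesis .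
qed

text \<open>Here \<open>ln x \<le> x - 1\<close> is used at \<open>p\<^sub>a / r\<^sub>a\<close>; the bound is the chi-squared distance.\<close>

lemma kl_div_le:
  assumes "\<And>a. p a \<ge> 0" "\<And>a. r a > 0" "sum p UNIV = 1" "sum r UNIV = 1"
  shows "kl_div p r \<le> (\<Sum>a\<in>UNIV. (p a - r a)\<^sup>2 / r a)"
proof -
  have pt: "p a * (ln (p a) - ln (r a)) \<le> p a * (p a / r a - 1)" for a
  proof (cases "p a = 0")
    case False
    then have pos: "p a > 0" "r a > 0" using assms(1,2)[of a] by auto
    then show ?thesis using ln_le_minus_one[of "p a / r a"]
      by (intro mult_left_mono) (auto simp: ln_div)
  qed simp
  have eq: "(p a - r a)\<^sup>2 / r a = p a * (p a / r a - 1) + (r a - p a)" for a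
    using assms(2)[of a] by (simp add: field_simps power2_eq_square)
  have "kl_div p r \<le> (\<Sum>a\<in>UNIV. p a * (p a / r a - 1))"
    unfolding kl_div_def by (intro sum_mono pt)
  also have "\<dots> = (\<Sum>a\<in>UNIV. p a * (p a / r a - 1) + (r a - p a))"
    using assms(3,4) by (simp add: sum.distrib sum_subtractf)
  finally show ?thesis by (simp add: eq)
qed

definition log_lik :: "nat \<Rightarrow> 'a::finite list \<Rightarrow> 'a list \<Rightarrow> real" where
  "log_lik d xs w = (\<Sum>a\<in>UNIV. letter_count d xs w a * ln (emp_prob d xs a w))"

lemma emp_prob_nonneg [simp]: "emp_prob d xs a w \<ge> 0"
  by (simp add: emp_prob_def)

lemma letter_count_le_word_count: "letter_count d xs w a \<le> word_count d xs w"
  unfolding word_count_def by (rule member_le_sum) auto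

lemma emp_prob_pos: "letter_count d xs w a > 0 \<Longrightarrow> emp_prob d xs a w > 0"
  using letter_count_le_word_count[of d xs w a] by (simp add: emp_prob_def)

lemma sum_emp_prob: "word_count d xs w > 0 \<Longrightarrow> (\<Sum>a\<in>UNIV. emp_prob d xs a w) = 1"
  unfolding emp_prob_def by (simp flip: sum_divide_distrib of_nat_sum word_count_def)

lemma letter_count_emp_prob:
  "real (letter_count d xs w a) = word_count d xs w * emp_prob d xs a w"
  using letter_count_le_word_count[of d xs w a] by (cases "word_count d xs w = 0") (auto simp: emp_prob_def)

text \<open>Any reference distribution \<open>r\<close> may be used to split off the cross term, which is additive
  over subtrees; only the divergences change when a subtree is replaced.\<close>

lemma log_lik_kl_div:
  "log_lik d xs w = (\<Sum>a\<in>UNIV. letter_count d xs w a * ln (r a)) +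
     word_count d xs w * kl_div (\<lambda>a. emp_prob d xs a w) r"
  unfolding log_lik_def kl_div_def sum_distrib_left sum.distrib[symmetric]
  by (intro sum.cong refl) (simp add: letter_count_emp_prob algebra_simps)

lemma sum_log_lik_subtree:
  assumes "subtree_at s S" "finite S" "\<And>v. v \<in> S \<Longrightarrow> length v \<le> d" "length s \<le> d"
  shows "(\<Sum>v\<in>S. log_lik d xs v) = (\<Sum>a\<in>UNIV. letter_count d xs s a * ln (r a)) +
     (\<Sum>v\<in>S. word_count d xs v * kl_div (\<lambda>a. emp_prob d xs a v) r)"
proof -
  have "(\<Sum>v\<in>S. \<Sum>a\<in>UNIV. real (letter_count d xs v a) * ln (r a)) =
      (\<Sum>a\<in>UNIV. real (letter_count d xs s a) * ln (r a))"
    by (subst sum.swap) (simp add: letter_count_subtree[OF assms] sum_distrib_right)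
  then show ?thesis by (subst log_lik_kl_div[where r = r]) (simp add: sum.distrib)
qed

lemma feasible_finite_words:
  assumes "T \<in> feasible_trees d xs"
  shows "SemiInf x \<notin> T" "Fin w \<in> T \<Longrightarrow> length w \<le> d"
    and "T = Fin ` {w. Fin w \<in> T}" "finite {w. Fin w \<in> T}"
proof -
  have le: "len u \<le> enat d" if "u \<in> T" for u
    using assms that SUP_upper[of u T len] unfolding feasible_trees_def height_def
    using order_trans by blast
  show no: "SemiInf x \<notin> T" for x using le[of "SemiInf x"] by auto
  show l: "Fin w \<in> T \<Longrightarrow> length w \<le> d" for w using le[of "Fin w"] by auto
  show "T = Fin ` {w. Fin w \<in> T}"
  proof (intro set_eqI)
    fix u show "u \<in> T \<longleftrightarrow> u \<in> Fin ` {w. Fin w \<in> T}" using no by (cases u) auto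
  qed
  have "finite {w::'a list. set w \<subseteq> UNIV \<and> length w \<le> d}"
    by (rule finite_lists_length_le) simp
  then show "finite {w. Fin w \<in> T}" by (rule finite_subset[rotated]) (use l in auto)
qed

text \<open>A word that occurs in the sample is comparable with some leaf because the tree is complete.\<close>

lemma feasibleI:
  assumes "is_tree T" "complete_tree T" "\<And>x. SemiInf x \<notin> T"
    and "\<And>w. Fin w \<in> T \<Longrightarrow> length w \<le> d" "\<And>w. Fin w \<in> T \<Longrightarrow> word_count d xs w \<ge> 1"
  shows "T \<in> feasible_trees d xs"
proof -
  have "len u \<le> enat d" if "u \<in> T" for u using assms that by (cases u) auto
  then have "height T \<le> enat d" unfolding height_def by (rule SUP_least)
  moreover have "Fin w' \<in> T \<or> (\<exists>w\<in>T. Fin w' \<prec> w) \<or> (\<exists>s\<in>T. s \<prec> Fin w')" for w'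
  proof (cases "internal T w'")
    case False
    then obtain t where t: "suffix t w'" "Fin t \<in> T"
      using internal_or_leaf_suffix[OF assms(2), of w'] by blast
    then have "t = w' \<or> Fin t \<prec> Fin w'" by (simp add: suffix_order.le_less disj_commute)
    with t show ?thesis by blast
  qed (simp add: internal_def)
  ultimately show ?thesis using assms unfolding feasible_trees_def by blast
qed

definition tree_cost :: "nat \<Rightarrow> 'a::finite list \<Rightarrow> real \<Rightarrow> 'a seq set \<Rightarrow> real" where
  "tree_cost d xs c T = - ln (ml_prob d xs T) + real (card T) * c"

lemma tree_cost_eq:
  assumes "T \<in> feasible_trees d xs"
  shows "tree_cost d xs c T = (\<Sum>w\<in>{w. Fin w \<in> T}. c - log_lik d xs w)"
proof -
  let ?W = "{w. Fin w \<in> T}"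
  have pos: "emp_prob d xs a w ^ letter_count d xs w a > 0" for a w
    using emp_prob_pos[of d xs w a] by (cases "letter_count d xs w a = 0") auto
  have ln: "ln (emp_prob d xs a w ^ letter_count d xs w a) =
      letter_count d xs w a * ln (emp_prob d xs a w)" for a w
    using emp_prob_pos[of d xs w a] by (cases "letter_count d xs w a = 0") (auto simp: ln_realpow)
  have "ln (ml_prob d xs T) =
      (\<Sum>w\<in>?W. ln (\<Prod>a\<in>UNIV. emp_prob d xs a w ^ letter_count d xs w a))"
    unfolding ml_prob_def
    by (intro ln_prod feasible_finite_words(4)[OF assms] less_imp_neq[THEN not_sym] prod_pos pos)
  also have "\<dots> = (\<Sum>w\<in>?W. log_lik d xs w)"
    unfolding log_lik_def ln[symmetric] by (intro sum.cong refl ln_prod finite less_imp_neq[THEN not_sym] pos)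
  finally have "ln (ml_prob d xs T) = (\<Sum>w\<in>?W. log_lik d xs w)" .
  moreover have "card T = card ?W"
    by (subst feasible_finite_words(3)[OF assms]) (simp add: card_image inj_on_def)
  ultimately show ?thesis
    by (simp add: tree_cost_def sum_subtractf)
qed

text \<open>The leaves that are not below \<open>s\<close> contribute equally to both trees.\<close>

lemma cost_graft:
  assumes T: "T \<in> feasible_trees d xs" and opt: "\<And>T'. T' \<in> feasible_trees d xs \<Longrightarrow>
      tree_cost d xs c T \<le> tree_cost d xs c T'"
    and s: "Fin s \<in> T \<or> internal T s" and S: "subtree_at s S" "finite S"
    and le: "\<And>v. v \<in> S \<Longrightarrow> length v \<le> d" and pos: "\<And>v. v \<in> S \<Longrightarrow> word_count d xs v \<ge> 1"
  shows "(\<Sum>v\<in>{v. Fin v \<in> T \<and> suffix s v}. c - log_lik d xs v) \<le> (\<Sum>v\<in>S. c - log_lik d xs v)"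
proof -
  have tree: "is_tree T" "complete_tree T" using T by (auto simp: feasible_trees_def)
  let ?T' = "graft T s S" and ?O = "{v. Fin v \<in> T \<and> \<not> suffix s v}"
  have mem: "Fin w \<in> ?T' \<longleftrightarrow> w \<in> ?O \<or> w \<in> S" for w by (auto simp: graft_def)
  have T': "?T' \<in> feasible_trees d xs"
  proof (rule feasibleI)
    show "is_tree ?T'" "complete_tree ?T'"
      using is_tree_graft complete_tree_graft tree s S by blast+
    show "SemiInf x \<notin> ?T'" for x using feasible_finite_words(1)[OF T] by (auto simp: graft_def)
    show "length w \<le> d" "word_count d xs w \<ge> 1" if "Fin w \<in> ?T'" for w
      using that feasible_finite_words(2)[OF T] le pos T unfolding mem feasible_trees_def by blast+
  qed
  have fin: "finite {w. Fin w \<in> T}" by (rule feasible_finite_words(4)[OF T])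
  have "{w. Fin w \<in> ?T'} = ?O \<union> S" using mem by auto
  moreover have "?O \<inter> S = {}" using S by (auto simp: subtree_at_def)
  moreover have "finite ?O" by (rule finite_subset[OF _ fin]) auto
  ultimately have 1: "tree_cost d xs c ?T' =
      (\<Sum>w\<in>?O. c - log_lik d xs w) + (\<Sum>w\<in>S. c - log_lik d xs w)"
    using S(2) by (simp add: tree_cost_eq[OF T'] sum.union_disjoint)
  let ?B = "{v. Fin v \<in> T \<and> suffix s v}"
  have split: "{w. Fin w \<in> T} = ?O \<union> ?B" by auto
  have "finite ?B" by (rule finite_subset[OF _ fin]) auto
  with \<open>finite ?O\<close> have 2: "tree_cost d xs c T =
      (\<Sum>w\<in>?O. c - log_lik d xs w) + (\<Sum>v\<in>?B. c - log_lik d xs v)"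
    unfolding tree_cost_eq[OF T] split by (intro sum.union_disjoint) auto
  from opt[OF T'] 1 2 show ?thesis by simp
qed

section \<open>Large deviations for word counts\<close>

abbreviation words :: "nat \<Rightarrow> 'a list set" where
  "words n \<equiv> {w. length w = n}"

lemma finite_words [simp]: "finite (words n :: 'a::finite list set)"
  using finite_lists_length_eq[of "UNIV::'a set" n] by simp

lemma words_0: "words 0 = {[]}" by auto

lemma sum_words_Suc_snoc:
  "(\<Sum>w\<in>words (Suc n). g w) = (\<Sum>w\<in>words n. \<Sum>a\<in>(UNIV::'a::finite set). g (w @ [a]))"
proof -
  have "words (Suc n) = (\<lambda>(w, a). w @ [a]) ` (words n \<times> (UNIV::'a set))"
  proof (intro set_eqI iffI)
    fix w :: "'a list" assume "w \<in> words (Suc n)"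
    then have "w = (\<lambda>(w, a). w @ [a]) (butlast w, last w)" "butlast w \<in> words n"
      by auto (metis append_butlast_last_id length_greater_0_conv zero_less_Suc)
    then show "w \<in> (\<lambda>(w, a). w @ [a]) ` (words n \<times> UNIV)" by blast
  qed auto
  moreover have "inj_on (\<lambda>(w, a::'a). w @ [a]) (words n \<times> UNIV)" by (auto simp: inj_on_def)
  ultimately show ?thesis
    by (simp add: sum.reindex comp_def case_prod_unfold sum.cartesian_product)
qed

lemma sum_words_add:
  "(\<Sum>w\<in>words (m + n). g w) = (\<Sum>w\<in>words m. \<Sum>u\<in>words n. g (w @ (u :: 'a::finite list)))"
proof (induction n arbitrary: g)
  case 0
  then show ?case by (simp add: words_0)
next
  case (Suc n)
  have "(\<Sum>w\<in>words (m + Suc n). g w) = (\<Sum>w\<in>words m. \<Sum>u\<in>words n. \<Sum>a\<in>UNIV. g (w @ u @ [a]))"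
    by (simp only: add_Suc_right sum_words_Suc_snoc[of g] Suc.IH append_assoc)
  also have "\<dots> = (\<Sum>w\<in>words m. \<Sum>u\<in>words (Suc n). g (w @ u))"
    by (simp only: sum_words_Suc_snoc)
  finally show ?case .
qed

text \<open>The elementary inequality behind the moment bound for bounded supermartingale increments.\<close>

lemma exp_le_quadratic:
  assumes "\<bar>y\<bar> \<le> (1::real)"
  shows "exp y \<le> 1 + y + y\<^sup>2"
proof (cases "y \<ge> 0")
  case True
  then show ?thesis using assms exp_bound[of y] by simp
next
  case False
  define z where "z = - y"
  have z: "z \<ge> 0" using False by (simp add: z_def)
  have "1 \<le> 1 + z\<^sup>2 / 2 + z ^ 3 / 2 + z ^ 4 / 2" using z by simp
  also have "\<dots> = (1 - z + z\<^sup>2) * (1 + z + z\<^sup>2 / 2)"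
    by (simp add: field_simps power2_eq_square power3_eq_cube power4_eq_xxxx)
  also have "\<dots> \<le> (1 - z + z\<^sup>2) * exp z"
  proof (intro mult_left_mono exp_lower_Taylor_quadratic z)
    have "1 - z + z\<^sup>2 = (1 - z)\<^sup>2 + z" by (simp add: power2_eq_square algebra_simps)
    then show "0 \<le> 1 - z + z\<^sup>2" using z by (simp only: add_nonneg_nonneg zero_le_power2)
  qed
  finally have "exp (- z) \<le> 1 - z + z\<^sup>2" by (simp add: exp_minus field_simps)
  then show ?thesis by (simp add: z_def)
qed

lemma card_short_words:
  assumes "CARD('a::finite) \<ge> 2"
  shows "real (card {v::'a list. length v \<le> d}) \<le> 2 * real CARD('a) ^ d"
proof -
  let ?c = "real CARD('a)"
  have "(\<Sum>i\<le>d. ?c ^ i) \<le> 2 * ?c ^ d"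
  proof (induction d)
    case (Suc d)
    have "2 * ?c ^ d \<le> ?c * ?c ^ d" using assms by (intro mult_right_mono) auto
    moreover have "(\<Sum>i\<le>Suc d. ?c ^ i) = (\<Sum>i\<le>d. ?c ^ i) + ?c * ?c ^ d" by simp
    moreover have "2 * ?c ^ Suc d = 2 * (?c * ?c ^ d)" by simp
    ultimately show ?case using Suc by linarith
  qed simp
  moreover have "card {v::'a list. length v \<le> d} = (\<Sum>i\<le>d. CARD('a) ^ i)"
    using card_lists_length_le[of "UNIV::'a set" d] by simp
  ultimately show ?thesis by simp
qed

lemma finite_short_words: "finite {v::'a::finite list. length v \<le> d}"
  using finite_lists_length_le[of "UNIV::'a set" d] by simp

text \<open>The law of a one-sided process, given by its consistent word probabilities. Expectations
  of functions of the first \<open>n\<close> letters are then finite sums, and conditioning on the first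
  letters of a word becomes induction from the right.\<close>

locale word_measure =
  fixes \<mu> :: "'a::finite list \<Rightarrow> real"
  assumes nonneg [simp]: "\<mu> w \<ge> 0" and Nil [simp]: "\<mu> [] = 1"
    and sum_snoc: "(\<Sum>a\<in>UNIV. \<mu> (w @ [a])) = \<mu> w"
begin

lemma sum_append: "(\<Sum>u\<in>words n. \<mu> (w @ u)) = \<mu> w"
proof (induction n)
  case (Suc n)
  then show ?case using sum_snoc[of "w @ _"] by (simp add: sum_words_Suc_snoc)
qed (simp add: words_0)

definition expect :: "nat \<Rightarrow> ('a list \<Rightarrow> real) \<Rightarrow> real" where
  "expect n g = (\<Sum>w\<in>words n. \<mu> w * g w)"

definition pr :: "nat \<Rightarrow> ('a list \<Rightarrow> bool) \<Rightarrow> real" where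
  "pr n P = (\<Sum>w\<in>{w\<in>words n. P w}. \<mu> w)"

lemma markov:
  assumes "\<And>w. w \<in> words n \<Longrightarrow> g w \<ge> 0" "\<And>w. w \<in> words n \<Longrightarrow> P w \<Longrightarrow> c \<le> g w"
    and "c > 0"
  shows "pr n P \<le> expect n g / c"
proof -
  have "pr n P * c = (\<Sum>w\<in>{w\<in>words n. P w}. \<mu> w * c)" by (simp add: pr_def sum_distrib_right)
  also have "\<dots> \<le> (\<Sum>w\<in>{w\<in>words n. P w}. \<mu> w * g w)"
    using assms by (intro sum_mono mult_left_mono) auto
  also have "\<dots> \<le> expect n g" unfolding expect_def
    using assms by (intro sum_mono2) auto
  finally show ?thesis using assms(3) by (simp add: field_simps)
qed

lemma pr_mono: "(\<And>w. w \<in> words n \<Longrightarrow> P w \<Longrightarrow> Q w) \<Longrightarrow> pr n P \<le> pr n Q"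
  unfolding pr_def by (intro sum_mono2) auto

lemma pr_disj: "pr n (\<lambda>w. P w \<or> Q w) \<le> pr n P + pr n Q"
proof -
  have "pr n (\<lambda>w. P w \<or> Q w) = (\<Sum>w\<in>{w\<in>words n. P w} \<union> {w\<in>words n. Q w}. \<mu> w)"
    unfolding pr_def by (intro sum.cong) auto
  also have "\<dots> \<le> pr n P + pr n Q"
    unfolding pr_def by (subst sum_Un) (auto intro!: sum_nonneg)
  finally show ?thesis .
qed

lemma pr_union:
  assumes "finite I"
  shows "pr n (\<lambda>w. \<exists>i\<in>I. P i w) \<le> (\<Sum>i\<in>I. pr n (P i))"
  using assms
proof (induction I)
  case empty
  then show ?case by (simp add: pr_def)
next
  case (insert i I)
  have "pr n (\<lambda>w. \<exists>i\<in>insert i I. P i w) \<le> pr n (P i) + pr n (\<lambda>w. \<exists>i\<in>I. P i w)"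
    using pr_disj[of n "P i"] by simp
  then show ?case using insert by simp
qed

text \<open>\<open>D h a\<close> is the increment when letter \<open>a\<close> follows history \<open>h\<close>. Since its conditional
  mean is not positive, the linear term of \<open>exp (l D) \<le> 1 + l D + l\<^sup>2\<close> can be dropped, and each
  letter multiplies the exponential moment by at most \<open>1 + l\<^sup>2\<close>.\<close>

lemma expect_exp_drift_le:
  fixes D :: "'a list \<Rightarrow> 'a \<Rightarrow> real"
  assumes bd: "\<And>h a. \<bar>D h a\<bar> \<le> 1" and drift: "\<And>h. (\<Sum>a\<in>UNIV. \<mu> (h @ [a]) * D h a) \<le> 0"
    and l: "0 \<le> l" "l \<le> 1"
  shows "expect n (\<lambda>w. exp (l * (\<Sum>j<n. D (take j w) (w ! j)))) \<le> exp (n * l\<^sup>2)"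
proof (induction n)
  case 0
  show ?case by (simp add: expect_def words_0)
next
  case (Suc n)
  let ?S = "\<lambda>w. \<Sum>j<n. D (take j w) (w ! j)"
  have e: "exp (l * D h a) \<le> 1 + l * D h a + l\<^sup>2" for h a
  proof -
    have "\<bar>l * D h a\<bar> \<le> 1" using bd[of h a] l by (simp add: abs_mult mult_le_one)
    then have "exp (l * D h a) \<le> 1 + l * D h a + (l * D h a)\<^sup>2"
      by (rule exp_le_quadratic)
    moreover have "(l * D h a)\<^sup>2 \<le> l\<^sup>2"
      using bd[of h a] by (simp add: power_mult_distrib mult_left_le abs_square_le_1)
    ultimately show ?thesis by linarith
  qed
  have step: "(\<Sum>a\<in>UNIV. \<mu> (h @ [a]) * exp (l * D h a)) \<le> \<mu> h * exp (l\<^sup>2)" for h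
  proof -
    have "(\<Sum>a\<in>UNIV. \<mu> (h @ [a]) * exp (l * D h a)) \<le>
        (\<Sum>a\<in>UNIV. \<mu> (h @ [a]) * (1 + l * D h a + l\<^sup>2))"
      by (intro sum_mono mult_left_mono e) auto
    also have "\<dots> = (\<Sum>a\<in>UNIV. \<mu> (h @ [a])) * (1 + l\<^sup>2) + l * (\<Sum>a\<in>UNIV. \<mu> (h @ [a]) * D h a)"
      by (simp add: sum_distrib_left sum_distrib_right sum.distrib[symmetric] algebra_simps)
    also have "\<dots> \<le> \<mu> h * (1 + l\<^sup>2)"
      using drift[of h] l by (simp add: sum_snoc mult_nonneg_nonpos)
    also have "\<dots> \<le> \<mu> h * exp (l\<^sup>2)"
      using exp_ge_add_one_self[of "l\<^sup>2"] by (intro mult_left_mono) auto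
    finally show ?thesis .
  qed
  have "expect (Suc n) (\<lambda>w. exp (l * (\<Sum>j<Suc n. D (take j w) (w ! j)))) =
      (\<Sum>w\<in>words n. exp (l * ?S w) * (\<Sum>a\<in>UNIV. \<mu> (w @ [a]) * exp (l * D w a)))"
    unfolding expect_def sum_words_Suc_snoc sum_distrib_left
    by (intro sum.cong refl) (auto simp: nth_append exp_add distrib_left intro!: sum.cong)
  also have "\<dots> \<le> (\<Sum>w\<in>words n. exp (l * ?S w) * (\<mu> w * exp (l\<^sup>2)))"
    by (intro sum_mono mult_left_mono step) auto
  also have "\<dots> = expect n (\<lambda>w. exp (l * ?S w)) * exp (l\<^sup>2)"
    unfolding expect_def sum_distrib_right by (intro sum.cong) auto
  also have "\<dots> \<le> exp (n * l\<^sup>2) * exp (l\<^sup>2)" by (intro mult_right_mono Suc.IH) auto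
  finally show ?case by (simp add: exp_add[symmetric] algebra_simps)
qed

text \<open>Markov's inequality for the exponential moment with the optimal \<open>l = B / (2 n)\<close>.\<close>

lemma drift_deviation:
  fixes D :: "'a list \<Rightarrow> 'a \<Rightarrow> real"
  assumes bd: "\<And>h a. \<bar>D h a\<bar> \<le> 1" and drift: "\<And>h. (\<Sum>a\<in>UNIV. \<mu> (h @ [a]) * D h a) \<le> 0"
    and B: "0 \<le> B" "B \<le> real n" and n: "n > 0"
  shows "pr n (\<lambda>w. B \<le> (\<Sum>j<n. D (take j w) (w ! j))) \<le> exp (- (B\<^sup>2 / (4 * n)))"
proof -
  define l where "l = B / (2 * n)"
  have l: "0 \<le> l" "l \<le> 1" using B n by (auto simp: l_def field_simps)
  have "pr n (\<lambda>w. B \<le> (\<Sum>j<n. D (take j w) (w ! j))) \<le>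
      expect n (\<lambda>w. exp (l * (\<Sum>j<n. D (take j w) (w ! j)))) / exp (l * B)"
    using l by (intro markov) (auto intro!: mult_left_mono)
  also have "\<dots> \<le> exp (n * l\<^sup>2) / exp (l * B)"
    by (intro divide_right_mono expect_exp_drift_le[OF bd drift l]) auto
  also have "\<dots> = exp (n * l\<^sup>2 - l * B)" by (simp add: exp_diff)
  also have "n * l\<^sup>2 - l * B = - (B\<^sup>2 / (4 * n))"
    using n by (simp add: l_def field_simps power2_eq_square)
  finally show ?thesis .
qed

end

text \<open>This is \<open>word_count\<close> in the form in which it extends along a growing sample: the histories
  from length \<open>d\<close> on that end in \<open>v\<close> and are followed by some letter.\<close>

definition occ :: "nat \<Rightarrow> 'a list \<Rightarrow> 'a list \<Rightarrow> nat" where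
  "occ d v w = card {j \<in> {d..<length w}. suffix v (take j w)}"

lemma occ_append: "occ d v w \<le> occ d v (w @ u)"
  unfolding occ_def by (intro card_mono) auto

lemma occ_append_Suc:
  assumes "length u = Suc k" "suffix v (w @ butlast u)" "d \<le> length w"
  shows "Suc (occ d v w) \<le> occ d v (w @ u)"
proof -
  let ?j = "length w + k"
  have "take ?j (w @ u) = w @ butlast u" using assms(1) by (simp add: butlast_conv_take)
  then have "insert ?j {j \<in> {d..<length w}. suffix v (take j w)} \<subseteq>
      {j \<in> {d..<length (w @ u)}. suffix v (take j (w @ u))}"
    using assms by auto
  then have "card (insert ?j {j \<in> {d..<length w}. suffix v (take j w)}) \<le> occ d v (w @ u)"
    unfolding occ_def by (intro card_mono) auto
  then show ?thesis by (simp add: occ_def)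
qed

lemma word_count_occ: "length v \<le> d \<Longrightarrow> word_count d w v = occ d v w"
  by (simp add: word_count_eq occ_def of_bool_def sum.If_cases Int_def)

locale positive_word_measure = word_measure \<mu> for \<mu> :: "'a::finite list \<Rightarrow> real" +
  fixes \<alpha> :: real
  assumes alpha_pos: "\<alpha> > 0" and alpha_le: "\<alpha> \<le> 1" and alpha: "\<alpha> * \<mu> w \<le> \<mu> (w @ [a])"
begin

lemma append_ge: "\<alpha> ^ length v * \<mu> w \<le> \<mu> (w @ v)"
proof (induction v rule: rev_induct)
  case (snoc a v)
  have "\<alpha> ^ length (v @ [a]) * \<mu> w \<le> \<alpha> * \<mu> (w @ v)"
    using mult_left_mono[OF snoc, of \<alpha>] alpha_pos by (simp add: mult.assoc)
  also have "\<dots> \<le> \<mu> ((w @ v) @ [a])" by (rule alpha)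
  finally show ?case by simp
qed simp

lemma suffix_prob_ge:
  assumes "length v \<le> k"
  shows "\<alpha> ^ length v * \<mu> w \<le> (\<Sum>u\<in>{u \<in> words k. suffix v u}. \<mu> (w @ u))"
proof -
  let ?m = "k - length v"
  have "\<alpha> ^ length v * \<mu> w = (\<Sum>u\<in>words ?m. \<alpha> ^ length v * \<mu> (w @ u))"
    by (simp add: sum_append sum_distrib_left[symmetric])
  also have "\<dots> \<le> (\<Sum>u\<in>words ?m. \<mu> ((w @ u) @ v))" by (intro sum_mono append_ge)
  also have "\<dots> = (\<Sum>u\<in>(\<lambda>u. u @ v) ` words ?m. \<mu> (w @ u))"
    by (subst sum.reindex) (auto simp: inj_on_def)
  also have "\<dots> \<le> (\<Sum>u\<in>{u \<in> words k. suffix v u}. \<mu> (w @ u))"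
    using assms by (intro sum_mono2) (auto simp: suffix_def)
  finally show ?thesis .
qed

text \<open>After the first \<open>d\<close> letters the sample is read in \<open>m\<close> blocks of length \<open>\<bar>v\<bar> + 1\<close>, the remaining
  \<open>r\<close> letters being ignored. Whatever the past, a block starts with \<open>v\<close> with probability at least
  \<open>p = \<alpha>\<^bsup>\<bar>v\<bar>\<^esup>\<close>, and this multiplies \<open>exp (- occ)\<close> by at most \<open>exp (- 1) \<le> 1 / 2\<close>. Every block
  thus contributes a factor \<open>1 - p / 2 \<le> exp (- p / 2)\<close>. The extra letter of a block is needed because an
  occurrence only counts if a letter follows it.\<close>

lemma expect_exp_occ_le:
  "expect (d + m * Suc (length v) + r) (\<lambda>w. exp (- real (occ d v w)))
    \<le> exp (- (m * \<alpha> ^ length v / 2))"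
proof -
  let ?k = "Suc (length v)" and ?p = "\<alpha> ^ length v"
  have mono: "expect (n + r) (\<lambda>w. exp (- real (occ d v w))) \<le>
      expect n (\<lambda>w. exp (- real (occ d v w)))" for n r
  proof -
    have "expect (n + r) (\<lambda>w. exp (- real (occ d v w))) \<le>
        (\<Sum>w\<in>words n. \<Sum>u\<in>words r. \<mu> (w @ u) * exp (- real (occ d v w)))"
      unfolding expect_def sum_words_add
      by (intro sum_mono mult_left_mono) (auto intro: occ_append)
    also have "\<dots> = expect n (\<lambda>w. exp (- real (occ d v w)))"
      by (simp add: sum_distrib_right[symmetric] sum_append expect_def)
    finally show ?thesis .
  qed
  have step: "expect (n + ?k) (\<lambda>w. exp (- real (occ d v w))) \<le>
      expect n (\<lambda>w. exp (- real (occ d v w))) * exp (- (?p / 2))" if "d \<le> n" for n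
  proof -
    have inner: "(\<Sum>u\<in>words ?k. \<mu> (w @ u) * exp (- real (occ d v (w @ u)))) \<le>
        \<mu> w * exp (- real (occ d v w)) * exp (- (?p / 2))" if w: "w \<in> words n" for w
    proof -
      let ?e = "exp (- real (occ d v w))"
      have pt: "\<mu> (w @ u) * exp (- real (occ d v (w @ u))) \<le>
          ?e * (\<mu> (w @ u) - \<mu> (w @ u) * (of_bool (suffix v (butlast u)) / 2))" if u: "u \<in> words ?k" for u
      proof (cases "suffix v (butlast u)")
        case True
        then have "Suc (occ d v w) \<le> occ d v (w @ u)"
          using u w \<open>d \<le> n\<close> by (intro occ_append_Suc) (auto intro: suffix_appendI)
        then have "exp (- real (occ d v (w @ u))) \<le> exp (- real (occ d v w) + (- 1))"
          by simp
        also have "\<dots> = ?e * exp (- 1)" by (rule exp_add)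
        also have "\<dots> \<le> ?e * (1 / 2)"
          using exp_ge_add_one_self[of "1::real"] by (intro mult_left_mono) (auto simp: exp_minus field_simps)
        finally have "\<mu> (w @ u) * exp (- real (occ d v (w @ u))) \<le> \<mu> (w @ u) * (?e * (1 / 2))"
          by (intro mult_left_mono) auto
        then show ?thesis using True by (simp add: algebra_simps)
      next
        case False
        then show ?thesis using occ_append[of d v w u]
          by (simp add: mult.commute[of "exp _"] mult_left_mono)
      qed
      have "?p * \<mu> w \<le> (\<Sum>u\<in>{u \<in> words (length v). suffix v u}. \<mu> (w @ u))"
        by (rule suffix_prob_ge) simp
      also have "\<dots> = (\<Sum>u\<in>words (length v). \<Sum>a\<in>UNIV. \<mu> (w @ u @ [a]) * of_bool (suffix v u))"
        using sum_snoc[of "w @ _"] by (simp add: sum_distrib_right[symmetric] Int_def conj_commute flip: sum.inter_filter)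
      also have "\<dots> = (\<Sum>u\<in>words ?k. \<mu> (w @ u) * of_bool (suffix v (butlast u)))"
        by (subst sum_words_Suc_snoc) simp
      finally have p: "?p * \<mu> w \<le> \<dots>" .
      have "(\<Sum>u\<in>words ?k. \<mu> (w @ u) * exp (- real (occ d v (w @ u)))) \<le>
          (\<Sum>u\<in>words ?k. ?e * (\<mu> (w @ u) - \<mu> (w @ u) * (of_bool (suffix v (butlast u)) / 2)))"
        by (intro sum_mono pt)
      also have "\<dots> = ?e * (\<mu> w - (\<Sum>u\<in>words ?k. \<mu> (w @ u) * of_bool (suffix v (butlast u))) / 2)"
        by (simp only: sum_distrib_left[symmetric] sum_subtractf sum_append times_divide_eq_right
            sum_divide_distrib)
      also have "\<dots> \<le> ?e * (\<mu> w - ?p * \<mu> w / 2)" using p by (intro mult_left_mono) auto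
      also have "\<dots> = \<mu> w * ?e * (1 - ?p / 2)" by (simp add: algebra_simps)
      also have "\<dots> \<le> \<mu> w * ?e * exp (- (?p / 2))"
        using exp_ge_add_one_self[of "- (?p / 2)"] by (intro mult_left_mono) auto
      finally show ?thesis .
    qed
    show ?thesis unfolding expect_def sum_words_add sum_distrib_right
      using inner by (intro sum_mono) (auto simp: mult.assoc)
  qed
  have "expect (d + m * ?k) (\<lambda>w. exp (- real (occ d v w))) \<le> exp (- (m * ?p / 2))"
  proof (induction m)
    case 0
    have "expect d (\<lambda>w. exp (- real (occ d v w))) \<le> expect d (\<lambda>w. 1)"
      unfolding expect_def by (intro sum_mono mult_left_mono) auto
    also have "\<dots> = 1" using sum_append[where n = d and w = "[]"] by (simp add: expect_def)
    finally show ?case by simp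
  next
    case (Suc m)
    have eq: "d + Suc m * ?k = (d + m * ?k) + ?k" by simp
    have "expect (d + Suc m * ?k) (\<lambda>w. exp (- real (occ d v w))) \<le>
        expect (d + m * ?k) (\<lambda>w. exp (- real (occ d v w))) * exp (- (?p / 2))"
      unfolding eq by (rule step) simp
    also have "\<dots> \<le> exp (- (m * ?p / 2)) * exp (- (?p / 2))"
      by (intro mult_right_mono Suc.IH) auto
    also have "\<dots> = exp (- (Suc m * ?p / 2))"
      by (simp add: exp_add[symmetric] field_simps)
    finally show ?case .
  qed
  with mono[of "d + m * ?k" r] show ?thesis by linarith
qed

text \<open>Markov's inequality at half the exponent of the moment bound.\<close>

lemma occ_deviation:
  "pr (d + m * Suc (length v) + r) (\<lambda>w. real (occ d v w) \<le> m * \<alpha> ^ length v / 4)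
     \<le> exp (- (m * \<alpha> ^ length v / 4))"
proof -
  let ?n = "d + m * Suc (length v) + r" and ?x = "m * \<alpha> ^ length v / 4"
  have "pr ?n (\<lambda>w. real (occ d v w) \<le> ?x) \<le> expect ?n (\<lambda>w. exp (- real (occ d v w))) / exp (- ?x)"
    by (intro markov) auto
  also have "\<dots> \<le> exp (- (2 * ?x)) / exp (- ?x)"
    using expect_exp_occ_le[where d = d and m = m and v = v and r = r] by (intro divide_right_mono) auto
  also have "\<dots> = exp (- (2 * ?x) - (- ?x))" by (simp only: exp_diff)
  finally show ?thesis by simp
qed

end

section \<open>Word probabilities and the transition kernel\<close>

locale kernel_process = prob_space M
  for M :: "'w measure" +
  fixes X :: "int \<Rightarrow> 'w \<Rightarrow> 'a::finite" and q :: "(nat \<Rightarrow> 'a) \<Rightarrow> 'a pmf"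
  assumes X_measurable [measurable]: "\<And>t. X t \<in> measurable M (count_space UNIV)"
    and stat: "stationary M X" and version: "cond_law_version M X q"
begin

abbreviation "\<mu> \<equiv> word_prob M X"

lemma block_eq_iff:
  "block X s t \<omega> = w \<longleftrightarrow> length w = nat (t - s + 1) \<and> (\<forall>i\<in>{..<length w}. X (s + int i) \<omega> = w ! i)"
  unfolding block_def list_eq_iff_nth_eq by (auto simp: nth_upto)

lemma sets_block_eq [measurable]: "{\<omega> \<in> space M. block X s t \<omega> = w} \<in> sets M"
  unfolding block_eq_iff by measurable

lemma sets_block: "{\<omega> \<in> space M. P (block X s t \<omega>)} \<in> sets M"
proof -
  have "{\<omega> \<in> space M. P (block X s t \<omega>)} =
      (\<Union>w\<in>{w \<in> words (nat (t - s + 1)). P w}. {\<omega> \<in> space M. block X s t \<omega> = w})"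
    by (auto simp: block_def)
  also have "\<dots> \<in> sets M" by (intro sets.finite_UN sets_block_eq) (simp add: finite_words[simplified])
  finally show ?thesis .
qed

text \<open>Stationarity is an equality of laws on path space, so the event is first written as a
  set of paths.\<close>

lemma prob_block_shift:
  "prob {\<omega> \<in> space M. block X (s + 1) (t + 1) \<omega> = w} = prob {\<omega> \<in> space M. block X s t \<omega> = w}"
proof (cases "length w = nat (t - s + 1)")
  case False
  then have "block X (s + 1) (t + 1) \<omega> \<noteq> w" "block X s t \<omega> \<noteq> w" for \<omega>
    by (auto simp: block_def)
  then show ?thesis by simp
next
  case True
  let ?P = "path_space :: (int \<Rightarrow> 'a) measure"
  let ?L = "process_law M X"
  define E where "E = {x \<in> space ?P. (\<forall>i\<in>{..<length w}. x (s + int i) = w ! i)}"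
  have [measurable]: "(\<lambda>\<omega> t. X t \<omega>) \<in> measurable M ?P"
    by (rule measurable_PiM_single') (auto simp: space_PiM)
  have [measurable]: "shift \<in> measurable ?P ?P"
    unfolding shift_def by (rule measurable_PiM_single') (auto simp: space_PiM)
  have [measurable]: "(\<lambda>x. x i) \<in> measurable ?P (count_space UNIV)" for i
    by (rule measurable_component_singleton) simp
  have [measurable]: "E \<in> sets ?P" unfolding E_def by measurable
  have sp: "space ?P = UNIV" by (auto simp: space_PiM)
  have "measure ?L E = prob ((\<lambda>\<omega> t. X t \<omega>) -` E \<inter> space M)"
    unfolding process_law_def by (rule measure_distr) measurable
  also have "(\<lambda>\<omega> t. X t \<omega>) -` E \<inter> space M = {\<omega> \<in> space M. block X s t \<omega> = w}"
    unfolding E_def block_eq_iff sp using True by auto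
  finally have 1: "measure ?L E = prob {\<omega> \<in> space M. block X s t \<omega> = w}" .
  have "distr ?L ?P shift = distr M ?P (shift \<circ> (\<lambda>\<omega> t. X t \<omega>))"
    unfolding process_law_def by (rule distr_distr) measurable
  then have "measure (distr ?L ?P shift) E = prob ((shift \<circ> (\<lambda>\<omega> t. X t \<omega>)) -` E \<inter> space M)"
    by (simp only:) (rule measure_distr, measurable)
  also have "(shift \<circ> (\<lambda>\<omega> t. X t \<omega>)) -` E \<inter> space M =
      {\<omega> \<in> space M. block X (s + 1) (t + 1) \<omega> = w}"
    unfolding E_def block_eq_iff sp using True by (auto simp: shift_def ac_simps)
  finally have "prob {\<omega> \<in> space M. block X (s + 1) (t + 1) \<omega> = w} = measure (distr ?L ?P shift) E" ..
  also have "\<dots> = measure ?L E" using stat by (simp add: stationary_def)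
  finally show ?thesis using 1 by simp
qed

lemma prob_block_shift_nat:
  "prob {\<omega> \<in> space M. block X (s + int n) (t + int n) \<omega> = w} = prob {\<omega> \<in> space M. block X s t \<omega> = w}"
proof (induction n)
  case (Suc n)
  then show ?case using prob_block_shift[of "s + int n" "t + int n" w] by (simp add: ac_simps)
qed simp

lemma word_prob_eq_past: "\<mu> w = prob {\<omega> \<in> space M. block X (- int (length w)) (- 1) \<omega> = w}"
  using prob_block_shift_nat[of "- int (length w)" "length w + 1" "-1" w] by (simp add: word_prob_def)

lemma word_prob_snoc_eq_past:
  "\<mu> (w @ [a]) = prob {\<omega> \<in> space M. block X (- int (length w)) (- 1) \<omega> = w \<and> X 0 \<omega> = a}"
proof -
  have "[- int (length w)..0] = [- int (length w)..- 1] @ [0]"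
    using upto_rec2[of "- int (length w)" 0] by simp
  then have "block X (- int (length w)) (- 1) \<omega> = w \<and> X 0 \<omega> = a \<longleftrightarrow>
      block X (- int (length w)) 0 \<omega> = w @ [a]" for \<omega>
    by (auto simp: block_def)
  then show ?thesis
    using prob_block_shift_nat[of "- int (length w)" "length w + 1" 0 "w @ [a]"]
    by (simp add: word_prob_def add.commute)
qed

lemma block_eq_recent: "block X (- int n) (- 1) \<omega> = recent (past X \<omega>) n"
  unfolding block_def recent_def past_def
  by (intro nth_equalityI) (auto simp: rev_nth nth_upto algebra_simps of_nat_diff)

lemma past_in_cylinder:
  "past X \<omega> \<in> cylinder w \<longleftrightarrow> block X (- int (length w)) (- 1) \<omega> = w"
  by (simp add: cylinder_def block_eq_recent)

lemma past_measurable [measurable]: "past X \<in> measurable M path_space"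
  unfolding past_def by (rule measurable_PiM_single') (auto simp: space_PiM)

lemma sets_cylinder [measurable]: "cylinder w \<in> sets (path_space :: (nat \<Rightarrow> 'a) measure)"
proof -
  have [measurable]: "(\<lambda>x. x i) \<in> measurable path_space (count_space (UNIV::'a set))" for i :: nat
    by (rule measurable_component_singleton) simp
  have "cylinder w = {x \<in> space (path_space :: (nat \<Rightarrow> 'a) measure). \<forall>i\<in>{..<length w}. x i = rev w ! i}"
    unfolding cylinder_def recent_def space_PiM rev_swap list_eq_iff_nth_eq[of "map _ _"] by auto
  also have "\<dots> \<in> sets path_space" by measurable
  finally show ?thesis .
qed

lemma kernel_measurable [measurable]: "(\<lambda>\<omega>. pmf (q (past X \<omega>)) a) \<in> borel_measurable M"
proof -
  have [measurable]: "(\<lambda>x. pmf (q x) a) \<in> borel_measurable path_space"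
    using version by (simp add: cond_law_version_def)
  show ?thesis by measurable
qed

text \<open>This is the defining property of conditional expectation, integrated over the event that the
  past ends in \<open>w\<close>, followed by passing to the version \<open>q\<close>.\<close>

lemma word_prob_snoc_eq_integral:
  "\<mu> (w @ [a]) = (\<integral>\<omega>. indicator {\<omega> \<in> space M. past X \<omega> \<in> cylinder w} \<omega> * pmf (q (past X \<omega>)) a \<partial>M)"
proof -
  define F where "F = vimage_algebra (space M) (past X) (path_space :: (nat \<Rightarrow> 'a) measure)"
  define A where "A = {\<omega> \<in> space M. past X \<omega> \<in> cylinder w}"
  define f :: "'w \<Rightarrow> real" where "f = indicator {\<omega> \<in> space M. X 0 \<omega> = a}"
  have "subalgebra M F"
    unfolding subalgebra_def F_def using past_measurable by (simp add: measurable_iff_sets)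
  then interpret F: finite_measure_subalgebra M F by unfold_locales
  have A: "A \<in> sets F" unfolding A_def F_def
    using in_vimage_algebra[OF sets_cylinder[of w], where f = "past X" and X = "space M"]
    by (simp add: vimage_def Int_def conj_commute)
  then have A_M [measurable]: "A \<in> sets M" using \<open>subalgebra M F\<close> by (auto simp: subalgebra_def)
  have [measurable]: "f \<in> borel_measurable M" unfolding f_def by measurable
  have f: "integrable M f" unfolding f_def by (intro integrable_real_indicator) (auto simp: emeasure_eq_measure)
  have ae: "AE \<omega> in M. real_cond_exp M F f \<omega> = pmf (q (past X \<omega>)) a"
    using version unfolding cond_law_version_def f_def F_def by blast
  have "\<mu> (w @ [a]) = prob (A \<inter> {\<omega> \<in> space M. X 0 \<omega> = a})"
    unfolding word_prob_snoc_eq_past A_def past_in_cylinder by (intro arg_cong[where f = prob]) auto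
  also have "\<dots> = (\<integral>\<omega>. indicator (A \<inter> {\<omega> \<in> space M. X 0 \<omega> = a}) \<omega> \<partial>M)"
    by (simp add: Int_commute Int_absorb1 Int_assoc)
  also have "\<dots> = (\<integral>\<omega>\<in>A. f \<omega> \<partial>M)"
    unfolding set_lebesgue_integral_def f_def
    by (intro Bochner_Integration.integral_cong) (auto simp: indicator_def)
  also have "\<dots> = (\<integral>\<omega>\<in>A. real_cond_exp M F f \<omega> \<partial>M)" by (rule F.real_cond_exp_intA[OF f A])
  also have "\<dots> = (\<integral>\<omega>\<in>A. pmf (q (past X \<omega>)) a \<partial>M)"
    unfolding set_lebesgue_integral_def using ae by (intro integral_cong_AE) auto
  finally show ?thesis unfolding set_lebesgue_integral_def A_def by simp
qed

lemma word_prob_eq_integral: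
  "\<mu> w = (\<integral>\<omega>. indicator {\<omega> \<in> space M. past X \<omega> \<in> cylinder w} \<omega> \<partial>M)"
proof -
  have "{\<omega> \<in> space M. past X \<omega> \<in> cylinder w} \<inter> space M = {\<omega> \<in> space M. past X \<omega> \<in> cylinder w}"
    by auto
  then show ?thesis unfolding word_prob_eq_past past_in_cylinder by simp
qed

lemma integrable_kernel:
  "integrable M (\<lambda>\<omega>. indicator {\<omega> \<in> space M. past X \<omega> \<in> cylinder w} \<omega> * pmf (q (past X \<omega>)) a)"
  by (rule integrable_const_bound[where B = 1]) (auto simp: indicator_def pmf_le_1 intro!: AE_I2)

lemma integrable_cylinder:
  "integrable M (\<lambda>\<omega>. indicator {\<omega> \<in> space M. past X \<omega> \<in> cylinder w} \<omega> :: real)"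
  by (rule integrable_const_bound[where B = 1]) (auto simp: indicator_def intro!: AE_I2)

text \<open>The conditional probability of \<open>a\<close> after a finite history is an average of the kernel over
  the pasts that end in it.\<close>

lemma word_prob_snoc_ge:
  assumes "\<And>x. x \<in> cylinder w \<Longrightarrow> lo \<le> pmf (q x) a"
  shows "lo * \<mu> w \<le> \<mu> (w @ [a])"
proof -
  have "(\<integral>\<omega>. lo * indicator {\<omega> \<in> space M. past X \<omega> \<in> cylinder w} \<omega> \<partial>M) \<le> (\<integral>\<omega>. indicator {\<omega> \<in> space M. past X \<omega> \<in> cylinder w} \<omega> * pmf (q (past X \<omega>)) a \<partial>M)"
    by (intro integral_mono integrable_kernel integrable_mult_right integrable_cylinder)
       (auto simp: indicator_def assms)
  then show ?thesis
    by (simp only: word_prob_snoc_eq_integral[symmetric] integral_mult_right_zero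
        word_prob_eq_integral[symmetric])
qed

lemma word_prob_snoc_le:
  assumes "\<And>x. x \<in> cylinder w \<Longrightarrow> pmf (q x) a \<le> hi"
  shows "\<mu> (w @ [a]) \<le> hi * \<mu> w"
proof -
  have "(\<integral>\<omega>. indicator {\<omega> \<in> space M. past X \<omega> \<in> cylinder w} \<omega> * pmf (q (past X \<omega>)) a \<partial>M) \<le> (\<integral>\<omega>. hi * indicator {\<omega> \<in> space M. past X \<omega> \<in> cylinder w} \<omega> \<partial>M)"
    by (intro integral_mono integrable_kernel integrable_mult_right integrable_cylinder)
       (auto simp: indicator_def assms)
  then show ?thesis
    by (simp only: word_prob_snoc_eq_integral[symmetric] integral_mult_right_zero
        word_prob_eq_integral[symmetric])
qed

sublocale word_measure \<mu>
proof
  show "\<mu> w \<ge> 0" for w by (simp add: word_prob_def)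
  show "\<mu> [] = 1" by (simp add: word_prob_def block_def prob_space)
  show "(\<Sum>a\<in>UNIV. \<mu> (w @ [a])) = \<mu> w" for w
  proof -
    have "(\<Sum>a\<in>UNIV. \<mu> (w @ [a])) =
        (\<integral>\<omega>. (\<Sum>a\<in>UNIV. indicator {\<omega> \<in> space M. past X \<omega> \<in> cylinder w} \<omega> * pmf (q (past X \<omega>)) a) \<partial>M)"
      unfolding word_prob_snoc_eq_integral by (rule Bochner_Integration.integral_sum[symmetric]) (rule integrable_kernel)
    also have "\<dots> = \<mu> w"
      unfolding word_prob_eq_integral by (simp add: sum_distrib_left[symmetric] sum_pmf_eq_1)
    finally show ?thesis .
  qed
qed

lemma prob_block_eq_pr: "prob {\<omega> \<in> space M. P (block X 1 (int n) \<omega>)} = pr n P"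
proof -
  have "{\<omega> \<in> space M. P (block X 1 (int n) \<omega>)} =
      (\<Union>w\<in>{w \<in> words n. P w}. {\<omega> \<in> space M. block X 1 (int n) \<omega> = w})"
    by (auto simp: block_def)
  also have "prob \<dots> = (\<Sum>w\<in>{w \<in> words n. P w}. prob {\<omega> \<in> space M. block X 1 (int n) \<omega> = w})"
    by (intro finite_measure_finite_Union) (auto simp: disjoint_family_on_def sets_block_eq)
  also have "\<dots> = pr n P" unfolding pr_def word_prob_def by (intro sum.cong) auto
  finally show ?thesis .
qed

end

section \<open>The context tree and the continuity coefficients\<close>

context kernel_process
begin

abbreviation "T0 \<equiv> context_tree M X q"

lemma finite_context_in_T0 [simp]: "Fin w \<in> T0 \<longleftrightarrow> finite_context M X q w"
  by (auto simp: context_tree_def)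

lemma infinite_context_in_T0 [simp]: "SemiInf x \<in> T0 \<longleftrightarrow> infinite_context M X q x"
  by (auto simp: context_tree_def)

lemma is_tree_context_tree: "is_tree T0"
  unfolding is_tree_def
proof (intro ballI notI)
  fix u w :: "'a seq" assume u: "u \<in> T0" and w: "w \<in> T0" and "u \<prec> w"
  then obtain t where t: "u = Fin t" "Fin t \<prec> w" using prec_imp_Fin by blast
  have "finite_context M X q t" using u t by simp
  then show False using w t
    by (cases w) (auto simp: finite_context_def infinite_context_def)
qed

lemma context_of_past:
  "infinite_context M X q x \<or> (\<exists>s. x \<in> cylinder s \<and> finite_context M X q s)"
  by (auto simp: infinite_context_def)

lemma complete_context_tree: "complete_tree T0"
  unfolding complete_tree_def
proof
  fix x
  from context_of_past[of x] show "\<exists>s\<in>T0. s \<preceq> SemiInf x"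
  proof (elim disjE exE conjE)
    assume "infinite_context M X q x"
    then show ?thesis by (intro bexI[of _ "SemiInf x"]) (auto simp: suffix_eq_def)
  next
    fix s assume "x \<in> cylinder s" "finite_context M X q s"
    then show ?thesis by (intro bexI[of _ "Fin s"]) auto
  qed
qed

lemma finite_context_kernel:
  "finite_context M X q s \<Longrightarrow> x \<in> cylinder s \<Longrightarrow> trans_prob M X q a (Fin s) = pmf (q x) a"
  by (auto simp: finite_context_def determines_def)

text \<open>The infima in the continuity coefficients range over contexts. They bound the kernel at
  every past because the context of a past \<open>x\<close> determines \<open>q x\<close>; below an internal node \<open>u\<close>, that
  context is longer than \<open>u\<close>.\<close>

lemma kernel_eq_trans_prob:
  assumes "x \<in> cylinder u" "\<exists>w\<in>T0. Fin u \<prec> w"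
  obtains w where "w \<in> T0" "Fin u \<prec> w" "\<And>a. trans_prob M X q a w = pmf (q x) a"
proof -
  from context_of_past[of x] show thesis
  proof (elim disjE exE conjE)
    assume "infinite_context M X q x"
    then show thesis using assms by (intro that[of "SemiInf x"]) auto
  next
    fix s assume s: "x \<in> cylinder s" "finite_context M X q s"
    have "\<not> suffix s u"
    proof
      assume "suffix s u"
      then have "\<not> internal T0 u"
        using s leaf_suffix_not_internal[OF is_tree_context_tree, of s u] by simp
      then show False using assms(2) by (simp add: internal_def)
    qed
    then have "strict_suffix u s"
      using prec_comparable[of s "SemiInf x" u] s assms(1) by auto
    moreover have "trans_prob M X q a (Fin s) = pmf (q x) a" for a
      by (rule finite_context_kernel[OF s(2,1)])
    ultimately show thesis using s by (intro that[of "Fin s"]) simp_all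
  qed
qed

lemma trans_prob_nonneg: "trans_prob M X q a w \<ge> 0"
  by (cases w) (auto simp: cond_prob_def)

lemma bdd_below_trans_prob: "bdd_below ((\<lambda>w. trans_prob M X q a w) ` A)"
  by (rule bdd_belowI[of _ 0]) (auto simp: trans_prob_nonneg)

lemma kernel_ge_cont_coeff_0: "cont_coeff M X q 0 \<le> pmf (q x) a"
proof -
  obtain w where w: "w \<in> T0" "trans_prob M X q a w = pmf (q x) a"
    using context_of_past[of x] finite_context_kernel[of _ x a]
    by (metis finite_context_in_T0 infinite_context_in_T0 trans_prob.simps(2))
  have "cont_coeff M X q 0 \<le> (\<lambda>(w, a). trans_prob M X q a w) (w, a)"
    unfolding cont_coeff_def by simp (intro cINF_lower2[of _ _ "(w, a)"] bdd_belowI[of _ 0], use w in \<open>auto simp: trans_prob_nonneg\<close>)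
  then show ?thesis using w by simp
qed

text \<open>Both distributions dominate the same vector of infima, whose total mass is at least
  \<open>\<alpha>\<^sub>k\<close>, so they can differ by at most the remaining mass. If no context extends \<open>u\<close>, then \<open>u\<close> ends in a
  context and the distributions agree.\<close>

lemma kernel_continuity:
  assumes "k \<ge> 1" "length u = k" "x \<in> cylinder u" "y \<in> cylinder u"
  shows "pmf (q x) a \<le> pmf (q y) a + (1 - cont_coeff M X q k)"
proof -
  let ?W = "{w \<in> T0. Fin u \<prec> w}"
  let ?g = "\<lambda>u. if \<exists>w\<in>T0. Fin u \<prec> w
        then (\<Sum>a\<in>UNIV. INF w \<in> {w \<in> T0. Fin u \<prec> w}. trans_prob M X q a w) else 1"
  have cc: "cont_coeff M X q k \<le> ?g u"
  proof -
    have "cont_coeff M X q k = (INF u\<in>words k. ?g u)"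
      using assms(1) unfolding cont_coeff_def by simp
    also have "\<dots> \<le> ?g u"
      using assms(2) by (intro cINF_lower bdd_below_finite finite_imageI finite_words) simp
    finally show ?thesis .
  qed
  show ?thesis
  proof (cases "\<exists>w\<in>T0. Fin u \<prec> w")
    case True
    define m where "m b = (INF w\<in>?W. trans_prob M X q b w)" for b
    have le: "m b \<le> pmf (q z) b" if z: "z \<in> cylinder u" for z b
    proof -
      obtain w where "w \<in> T0" "Fin u \<prec> w" "\<And>a. trans_prob M X q a w = pmf (q z) a"
        using kernel_eq_trans_prob[OF z True] by blast
      then show ?thesis unfolding m_def
        using cINF_lower[OF bdd_below_trans_prob[of b ?W], of w] by simp
    qed
    have "pmf (q x) a - m a \<le> (\<Sum>b\<in>UNIV. pmf (q x) b - m b)"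
      using le[OF assms(3)] by (intro member_le_sum) auto
    also have "\<dots> = 1 - (\<Sum>b\<in>UNIV. m b)" by (simp add: sum_subtractf sum_pmf_eq_1)
    also have "\<dots> \<le> 1 - cont_coeff M X q k" using cc True by (simp add: m_def)
    finally show ?thesis using le[OF assms(4), of a] by linarith
  next
    case False
    then have "\<not> internal T0 u" by (simp add: internal_def)
    then obtain t where t: "suffix t u" "finite_context M X q t"
      using internal_or_leaf_suffix[OF complete_context_tree, of u] by auto
    then have "pmf (q x) a = pmf (q y) a"
      using finite_context_kernel[OF t(2) cylinder_mono[OF t(1) assms(3)], of a]
        finite_context_kernel[OF t(2) cylinder_mono[OF t(1) assms(4)], of a] by simp
    then show ?thesis using cc False by simp
  qed
qed

end

locale positive_process = kernel_process M X q
  for M :: "'w measure" and X :: "int \<Rightarrow> 'w \<Rightarrow> 'a::finite" and q +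
  assumes cont_coeff_0: "cont_coeff M X q 0 > 0"
begin

abbreviation "\<alpha> \<equiv> cont_coeff M X q 0"

sublocale positive_word_measure \<mu> \<alpha>
proof
  show "\<alpha> > 0" by (rule cont_coeff_0)
  show "\<alpha> \<le> 1" by (rule order_trans[OF kernel_ge_cont_coeff_0 pmf_le_1])
  show "\<alpha> * \<mu> w \<le> \<mu> (w @ [a])" for w a by (intro word_prob_snoc_ge kernel_ge_cont_coeff_0)
qed

lemma word_prob_pos: "\<mu> w > 0"
  using append_ge[where v = w and w = "[]"] zero_less_power[OF alpha_pos, of "length w"] by simp

text \<open>If the kernel is constant on the pasts ending in \<open>s\<close>, its value is also their average, which is
  the transition probability at the finite word \<open>s\<close>.\<close>

lemma determines_iff:
  "determines M X q s \<longleftrightarrow> (\<forall>x\<in>cylinder s. \<forall>y\<in>cylinder s. q x = q y)"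
proof
  assume "determines M X q s"
  then show "\<forall>x\<in>cylinder s. \<forall>y\<in>cylinder s. q x = q y"
    by (auto simp: determines_def intro!: pmf_eqI)
next
  assume const: "\<forall>x\<in>cylinder s. \<forall>y\<in>cylinder s. q x = q y"
  show "determines M X q s" unfolding determines_def
  proof (intro conjI allI impI)
    fix x a assume "Fin s \<prec> SemiInf x"
    then have x: "x \<in> cylinder s" by simp
    have "pmf (q y) a = pmf (q x) a" if "y \<in> cylinder s" for y
    proof -
      have "q y = q x" using const that x by blast
      then show ?thesis by (rule arg_cong)
    qed
    then have "\<mu> (s @ [a]) = pmf (q x) a * \<mu> s"
      using word_prob_snoc_ge[of s "pmf (q x) a" a] word_prob_snoc_le[of s a "pmf (q x) a"] by simp
    moreover have "{\<omega> \<in> space M. X 0 \<omega> = a \<and> block X (- int (length s)) (- 1) \<omega> = s} =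
        {\<omega> \<in> space M. block X (- int (length s)) (- 1) \<omega> = s \<and> X 0 \<omega> = a}" by auto
    then have "trans_prob M X q a (Fin s) = \<mu> (s @ [a]) / \<mu> s"
      unfolding word_prob_snoc_eq_past word_prob_eq_past[of s] trans_prob.simps cond_prob_def by simp
    ultimately show "trans_prob M X q a (SemiInf x) = trans_prob M X q a (Fin s)"
      using word_prob_pos[of s] by simp
  qed (rule word_prob_pos)
qed

lemma determines_suffix_context:
  "determines M X q s \<Longrightarrow> \<exists>t. suffix t s \<and> finite_context M X q t"
proof (induction "length s" arbitrary: s rule: less_induct)
  case less
  show ?case
  proof (cases "finite_context M X q s")
    case False
    then obtain t where "strict_suffix t s" "determines M X q t"
      using less.prems by (auto simp: finite_context_def)
    then show ?thesis using less.hyps[of t] suffix_length_less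
      by (meson suffix_order.less_imp_le suffix_order.trans)
  qed auto
qed

text \<open>A word on which the kernel is constant has a shortest suffix with this property, which is a
  context; a word without a context among its suffixes is internal by completeness.\<close>

lemma internal_context_tree_iff:
  "internal T0 s \<longleftrightarrow> (\<exists>x\<in>cylinder s. \<exists>y\<in>cylinder s. q x \<noteq> q y)"
proof -
  have "internal T0 s \<longleftrightarrow> \<not> determines M X q s"
  proof
    assume "internal T0 s"
    then show "\<not> determines M X q s"
      using determines_suffix_context[of s] leaf_suffix_not_internal[OF is_tree_context_tree, of _ s] by auto
  next
    assume nd: "\<not> determines M X q s"
    show "internal T0 s"
    proof (rule ccontr)
      assume "\<not> internal T0 s"
      then obtain t where "suffix t s" "finite_context M X q t"
        using internal_or_leaf_suffix[OF complete_context_tree, of s] by auto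
      then have "determines M X q s"
        unfolding determines_iff using cylinder_mono
        by (metis determines_iff finite_context_def)
      then show False using nd by simp
    qed
  qed
  then show ?thesis unfolding determines_iff by blast
qed

end

section \<open>Typical samples\<close>

context positive_process
begin

definition kernel_inf :: "'a list \<Rightarrow> 'a \<Rightarrow> real" where
  "kernel_inf v a = (INF x\<in>cylinder v. pmf (q x) a)"

definition kernel_sup :: "'a list \<Rightarrow> 'a \<Rightarrow> real" where
  "kernel_sup v a = (SUP x\<in>cylinder v. pmf (q x) a)"

lemma kernel_inf_le: "x \<in> cylinder v \<Longrightarrow> kernel_inf v a \<le> pmf (q x) a"
  unfolding kernel_inf_def by (intro cINF_lower bdd_belowI[of _ 0]) auto

lemma kernel_sup_ge: "x \<in> cylinder v \<Longrightarrow> pmf (q x) a \<le> kernel_sup v a"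
  unfolding kernel_sup_def by (intro cSUP_upper bdd_aboveI[of _ 1]) (auto simp: pmf_le_1)

lemma kernel_infI: "(\<And>x. x \<in> cylinder v \<Longrightarrow> c \<le> pmf (q x) a) \<Longrightarrow> c \<le> kernel_inf v a"
  unfolding kernel_inf_def using cylinder_nonempty[of v] by (intro cINF_greatest) auto

lemma kernel_supI: "(\<And>x. x \<in> cylinder v \<Longrightarrow> pmf (q x) a \<le> c) \<Longrightarrow> kernel_sup v a \<le> c"
  unfolding kernel_sup_def using cylinder_nonempty[of v] by (intro cSUP_least) auto

lemma kernel_inf_nonneg: "0 \<le> kernel_inf v a" by (intro kernel_infI) simp

lemma kernel_sup_le_1: "kernel_sup v a \<le> 1" by (intro kernel_supI pmf_le_1)

lemma kernel_inf_le_sup: "kernel_inf v a \<le> kernel_sup v a"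
  using cylinder_nonempty[of v] kernel_inf_le kernel_sup_ge order_trans by blast

text \<open>When the kernel is at most \<open>c\<close> on the pasts ending in \<open>v\<close>, the difference of the letter count
  and \<open>c\<close> times the word count is a supermartingale in the sample. The sign \<open>\<sigma>\<close> covers the lower
  deviation, with \<open>c\<close> a lower bound, by the same computation.\<close>

lemma letter_count_deviation:
  fixes \<sigma> c :: real
  assumes \<sigma>: "\<sigma> = 1 \<or> \<sigma> = - 1" and c: "0 \<le> c" "c \<le> 1"
    and le: "\<And>x. x \<in> cylinder v \<Longrightarrow> \<sigma> * pmf (q x) a \<le> \<sigma> * c"
    and v: "length v \<le> d" and B: "0 \<le> B" "B \<le> real n" and n: "n > 0"
  shows "pr n (\<lambda>w. B \<le> \<sigma> * (real (letter_count d w v a) - c * real (word_count d w v)))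
     \<le> exp (- (B\<^sup>2 / (4 * n)))"
proof -
  define D where "D h b = (if d \<le> length h \<and> suffix v h then \<sigma> * (of_bool (b = a) - c) else 0)"
    for h b
  have bd: "\<bar>D h b\<bar> \<le> 1" for h b using \<sigma> c by (auto simp: D_def)
  have drift: "(\<Sum>b\<in>UNIV. \<mu> (h @ [b]) * D h b) \<le> 0" for h
  proof (cases "d \<le> length h \<and> suffix v h")
    case True
    have "(\<Sum>b\<in>UNIV. \<mu> (h @ [b]) * D h b) =
        \<sigma> * ((\<Sum>b\<in>UNIV. \<mu> (h @ [b]) * of_bool (b = a)) - c * (\<Sum>b\<in>UNIV. \<mu> (h @ [b])))"
      unfolding sum_distrib_left sum_subtractf[symmetric] using True
      by (intro sum.cong) (auto simp: D_def algebra_simps)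
    also have "\<dots> = \<sigma> * \<mu> (h @ [a]) - \<sigma> * c * \<mu> h"
      by (simp add: sum_snoc algebra_simps)
    also have "\<dots> \<le> 0"
    proof -
      have cyl: "x \<in> cylinder v" if "x \<in> cylinder h" for x using that True cylinder_mono by blast
      show ?thesis
        using \<sigma> le[OF cyl] word_prob_snoc_le[of h a c] word_prob_snoc_ge[of h c a] by auto
    qed
    finally show ?thesis .
  qed (auto simp: D_def)
  have eq: "(\<Sum>j<n. D (take j w) (w ! j)) =
      \<sigma> * (real (letter_count d w v a) - c * real (word_count d w v))" if w: "w \<in> words n" for w
  proof -
    have "(\<Sum>j<n. D (take j w) (w ! j)) = (\<Sum>j\<in>{d..<n}. D (take j w) (w ! j))"
      using w by (intro sum.mono_neutral_right) (auto simp: D_def)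
    also have "\<dots> = (\<Sum>j\<in>{d..<n}. \<sigma> * (of_bool (suffix v (take j w) \<and> w ! j = a) -
        c * of_bool (suffix v (take j w))))"
      using w by (intro sum.cong) (auto simp: D_def)
    also have "\<dots> = \<sigma> * (real (letter_count d w v a) - c * real (word_count d w v))"
      using w by (simp only: letter_count_eq[OF v] word_count_eq[OF v] mem_Collect_eq of_nat_sum
          of_nat_of_bool sum_distrib_left[symmetric] sum_subtractf)
    finally show ?thesis .
  qed
  have "pr n (\<lambda>w. B \<le> \<sigma> * (real (letter_count d w v a) - c * real (word_count d w v))) \<le>
      pr n (\<lambda>w. B \<le> (\<Sum>j<n. D (take j w) (w ! j)))"
    by (intro pr_mono) (simp add: eq)
  also have "\<dots> \<le> exp (- (B\<^sup>2 / (4 * n)))" by (rule drift_deviation[OF bd drift B n])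
  finally show ?thesis .
qed

text \<open>When \<open>4 (d + 1) \<le> n\<close>, at most half of the sample is lost to the first \<open>d\<close> letters and the last incomplete block, so
  there are at least \<open>n / (2 (l + 1))\<close> blocks of length \<open>l + 1\<close>; \<open>occ_deviation\<close> guarantees a
  quarter of \<open>\<alpha>\<^bsup>l\<^esup>\<close> occurrences per block.\<close>

definition count_bound :: "nat \<Rightarrow> nat \<Rightarrow> real" where
  "count_bound n l = n * \<alpha> ^ l / (8 * (l + 1))"

lemma word_count_deviation:
  assumes v: "length v \<le> d" and n: "4 * (d + 1) \<le> n"
  shows "pr n (\<lambda>w. real (word_count d w v) \<le> count_bound n (length v)) \<le> exp (- count_bound n (length v))"
proof -
  let ?l = "length v"
  define m where "m = (n - d) div Suc ?l"
  define r where "r = (n - d) mod Suc ?l"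
  have "m * Suc ?l + r = n - d" unfolding m_def r_def by (rule div_mult_mod_eq)
  moreover have "n = d + (n - d)" using n by simp
  ultimately have n_eq: "n = d + m * Suc ?l + r" by (simp only: add.assoc)
  have "r < Suc ?l" by (simp add: r_def)
  have "n \<le> 2 * z" if "n = d + z + r" for z using that \<open>r < Suc ?l\<close> n v by presburger
  then have "n \<le> 2 * (m * Suc ?l)" using n_eq by blast
  then have "real n \<le> real (2 * (m * Suc ?l))" by (simp only: of_nat_le_iff)
  then have "real n / (2 * (?l + 1)) \<le> m" by (simp add: field_simps)
  then have "real n / (2 * (?l + 1)) * (\<alpha> ^ ?l / 4) \<le> m * (\<alpha> ^ ?l / 4)"
    using alpha_pos by (intro mult_right_mono) auto
  then have le: "count_bound n ?l \<le> m * \<alpha> ^ ?l / 4"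
    by (simp add: count_bound_def field_simps)
  have "pr n (\<lambda>w. real (word_count d w v) \<le> count_bound n ?l) \<le>
      pr n (\<lambda>w. real (occ d v w) \<le> m * \<alpha> ^ ?l / 4)"
    using le by (intro pr_mono) (simp add: word_count_occ[OF v])
  also have "\<dots> \<le> exp (- (m * \<alpha> ^ ?l / 4))"
    using occ_deviation[where d = d and m = m and v = v and r = r] n_eq by simp
  also have "\<dots> \<le> exp (- count_bound n ?l)" using le by simp
  finally show ?thesis .
qed

text \<open>For a word on which the kernel is constant, the two letter conditions say that the empirical
  transition probabilities are close to the true ones; for other words they confine them to the
  range of the kernel.\<close>

definition typical :: "nat \<Rightarrow> real \<Rightarrow> 'a list \<Rightarrow> bool" where
  "typical d B w \<longleftrightarrow> (\<forall>v. length v \<le> d \<longrightarrow>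
     count_bound (length w) (length v) < word_count d w v \<and>
     (\<forall>a. letter_count d w v a < kernel_sup v a * word_count d w v + B \<and>
          kernel_inf v a * word_count d w v - B < letter_count d w v a))"

lemma typicalD:
  assumes "typical d B w" "length v \<le> d"
  shows "count_bound (length w) (length v) < word_count d w v"
    and "letter_count d w v a < kernel_sup v a * word_count d w v + B"
    and "kernel_inf v a * word_count d w v - B < letter_count d w v a"
  using assms by (auto simp: typical_def)

lemma count_bound_antimono:
  assumes "l \<le> d" shows "count_bound n d \<le> count_bound n l"
proof -
  have "\<alpha> ^ d \<le> \<alpha> ^ l" using assms alpha_pos alpha_le by (intro power_decreasing) auto
  then show ?thesis unfolding count_bound_def
    using assms alpha_pos by (intro frac_le mult_left_mono) auto
qed

lemma count_bound_le: "count_bound n d \<le> n"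
proof -
  have "\<alpha> ^ d \<le> 1" using alpha_pos alpha_le by (intro power_le_one) auto
  then have "real n * \<alpha> ^ d \<le> real n * 1" by (intro mult_left_mono) auto
  also have "\<dots> \<le> real n * (8 * (d + 1))" by (intro mult_left_mono) auto
  finally show ?thesis by (simp add: count_bound_def field_simps)
qed

lemma count_bound_pos: "n > 0 \<Longrightarrow> count_bound n l > 0"
  using alpha_pos by (simp add: count_bound_def)

lemma pr_not_typical_le:
  assumes A: "CARD('a) \<ge> 2" and n: "4 * (d + 1) \<le> n" and B: "0 \<le> B" "B \<le> n"
  shows "pr n (\<lambda>w. \<not> typical d B w) \<le>
    2 * CARD('a) ^ d * (exp (- count_bound n d) + 2 * CARD('a) * exp (- (B\<^sup>2 / (4 * n))))"
proof -
  let ?V = "{v::'a list. length v \<le> d}" and ?E = "exp (- (B\<^sup>2 / (4 * n)))"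
  define few where "few v w \<longleftrightarrow> real (word_count d w v) \<le> count_bound n (length v)"
    for v w :: "'a list"
  define hi where "hi v a w \<longleftrightarrow> B \<le> 1 * (real (letter_count d w v a) - kernel_sup v a * real (word_count d w v))"
    for v w :: "'a list" and a
  define lo where "lo v a w \<longleftrightarrow> B \<le> - 1 * (real (letter_count d w v a) - kernel_inf v a * real (word_count d w v))"
    for v w :: "'a list" and a
  have "n > 0" using n by simp
  have few: "pr n (few v) \<le> exp (- count_bound n d)" if "v \<in> ?V" for v
  proof -
    have "pr n (few v) \<le> exp (- count_bound n (length v))"
      unfolding few_def using that n by (intro word_count_deviation) auto
    also have "\<dots> \<le> exp (- count_bound n d)" using count_bound_antimono that by simp
    finally show ?thesis .
  qed
  have hi: "pr n (hi v a) \<le> ?E" if "v \<in> ?V" for v a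
    unfolding hi_def using that B \<open>n > 0\<close> kernel_sup_le_1 kernel_sup_ge
      order_trans[OF kernel_inf_nonneg kernel_inf_le_sup]
    by (intro letter_count_deviation) auto
  have lo: "pr n (lo v a) \<le> ?E" if "v \<in> ?V" for v a
    unfolding lo_def using that B \<open>n > 0\<close> kernel_inf_nonneg kernel_inf_le
      order_trans[OF kernel_inf_le_sup kernel_sup_le_1]
    by (intro letter_count_deviation) auto
  have some_hi: "pr n (\<lambda>w. \<exists>a\<in>UNIV. hi v a w) \<le> CARD('a) * ?E" if "v \<in> ?V" for v
  proof -
    have "pr n (\<lambda>w. \<exists>a\<in>UNIV. hi v a w) \<le> (\<Sum>a\<in>UNIV. pr n (hi v a))" by (rule pr_union) simp
    also have "\<dots> \<le> CARD('a) * ?E" using hi[OF that] by (intro sum_bounded_above)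
    finally show ?thesis .
  qed
  have some_lo: "pr n (\<lambda>w. \<exists>a\<in>UNIV. lo v a w) \<le> CARD('a) * ?E" if "v \<in> ?V" for v
  proof -
    have "pr n (\<lambda>w. \<exists>a\<in>UNIV. lo v a w) \<le> (\<Sum>a\<in>UNIV. pr n (lo v a))" by (rule pr_union) simp
    also have "\<dots> \<le> CARD('a) * ?E" using lo[OF that] by (intro sum_bounded_above)
    finally show ?thesis .
  qed
  have each: "pr n (\<lambda>w. few v w \<or> (\<exists>a\<in>UNIV. hi v a w) \<or> (\<exists>a\<in>UNIV. lo v a w)) \<le>
      exp (- count_bound n d) + (CARD('a) * ?E + CARD('a) * ?E)" if "v \<in> ?V" for v
    using few[OF that] some_hi[OF that] some_lo[OF that]
      pr_disj[of n "few v" "\<lambda>w. (\<exists>a\<in>UNIV. hi v a w) \<or> (\<exists>a\<in>UNIV. lo v a w)"]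
      pr_disj[of n "\<lambda>w. \<exists>a\<in>UNIV. hi v a w" "\<lambda>w. \<exists>a\<in>UNIV. lo v a w"]
    by linarith
  have "pr n (\<lambda>w. \<not> typical d B w) \<le>
      pr n (\<lambda>w. \<exists>v\<in>?V. few v w \<or> (\<exists>a\<in>UNIV. hi v a w) \<or> (\<exists>a\<in>UNIV. lo v a w))"
    unfolding typical_def few_def hi_def lo_def by (intro pr_mono) (auto simp: not_less algebra_simps)
  also have "\<dots> \<le> (\<Sum>v\<in>?V. pr n (\<lambda>w. few v w \<or> (\<exists>a\<in>UNIV. hi v a w) \<or> (\<exists>a\<in>UNIV. lo v a w)))"
    by (intro pr_union finite_short_words)
  also have "\<dots> \<le> (\<Sum>v\<in>?V. exp (- count_bound n d) + (CARD('a) * ?E + CARD('a) * ?E))"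
    by (intro sum_mono each)
  also have "\<dots> = real (card ?V) * (exp (- count_bound n d) + 2 * CARD('a) * ?E)" by simp
  also have "\<dots> \<le> 2 * CARD('a) ^ d * (exp (- count_bound n d) + 2 * CARD('a) * ?E)"
    using card_short_words[OF A, of d] by (intro mult_right_mono) (auto intro: add_nonneg_nonneg)
  finally show ?thesis by simp
qed

text \<open>The constants are tuned so that \<open>\<bar>A\<bar> B\<^sup>2 / (\<alpha> N) \<le> c / 4\<close> for the deviation \<open>B\<close> and every count
  \<open>N\<close> of a typical sample with penalty \<open>c\<close>. This is the chi-squared bound on the likelihood that
  one superfluous leaf can gain.\<close>

definition slack :: real where
  "slack = \<alpha> / (4 * CARD('a))"

definition deviation_bound :: "real \<Rightarrow> nat \<Rightarrow> nat \<Rightarrow> real" where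
  "deviation_bound c d n = sqrt (slack * c * count_bound n d)"

lemma slack_pos: "slack > 0" and slack_le: "slack \<le> 1"
proof -
  show "slack > 0" using alpha_pos by (simp add: slack_def)
  have "real CARD('a) \<ge> 1" by (simp add: Suc_leI)
  then have "\<alpha> \<le> 4 * real CARD('a)" using alpha_le by linarith
  then show "slack \<le> 1" by (simp add: slack_def field_simps)
qed

text \<open>The letter exponent \<open>B\<^sup>2 / (4 n)\<close> is of order \<open>c \<alpha>\<^bsup>d\<^esup> / d\<close>; since
  \<open>c \<le> n\<close>, it is smaller than the exponent for the word counts. The constant factors are absorbed into the base of the \<open>d\<close>-th power.\<close>

lemma pr_not_typical_penalty:
  assumes A: "CARD('a) \<ge> 2" and n: "4 * (d + 1) \<le> n" and d: "d \<ge> 1" and c: "0 < c" "c \<le> n"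
  shows "pr n (\<lambda>w. \<not> typical d (deviation_bound c d n) w) \<le>
    2 * (1 + 2 * CARD('a)) * (CARD('a) ^ d * exp (- (c * (\<alpha> * slack / 64) ^ d / d)))"
proof -
  let ?B = "deviation_bound c d n" and ?E = "c * (\<alpha> * slack / 64) ^ d / d"
  have n0: "n > 0" using n by simp
  have B2: "?B\<^sup>2 = slack * c * count_bound n d"
    using slack_pos c count_bound_pos[OF n0, of d] by (simp add: deviation_bound_def)
  have "slack * c * count_bound n d \<le> 1 * real n * real n"
    using slack_pos slack_le c count_bound_pos[OF n0, of d] count_bound_le[of n d]
    by (intro mult_mono) auto
  then have "?B\<^sup>2 \<le> (real n)\<^sup>2" unfolding B2 by (simp add: power2_eq_square)
  then have Bn: "?B \<le> n" by (rule power2_le_imp_le) simp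
  have B0: "?B \<ge> 0" using slack_pos c count_bound_pos[OF n0, of d] by (simp add: deviation_bound_def)
  have "(slack / 64) ^ d \<le> (slack / 64) ^ 1" using d slack_pos slack_le by (intro power_decreasing) auto
  then have "\<alpha> ^ d * (slack / 64) ^ d \<le> \<alpha> ^ d * (slack / 64)"
    using alpha_pos by (intro mult_left_mono) auto
  then have p: "(\<alpha> * slack / 64) ^ d \<le> \<alpha> ^ d * slack / 64"
    by (simp add: power_mult_distrib power_divide)
  have "?E \<le> c * (\<alpha> ^ d * slack / 64) / d"
    using p c d by (intro divide_right_mono mult_left_mono) auto
  also have "\<dots> \<le> slack * c * (\<alpha> ^ d / (32 * (d + 1)))"
  proof -
    have "1 / (64 * real d) \<le> 1 / (32 * (d + 1))" using d by (intro frac_le) auto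
    then have "(slack * c * \<alpha> ^ d) * (1 / (64 * real d)) \<le> (slack * c * \<alpha> ^ d) * (1 / (32 * (d + 1)))"
      using slack_pos c alpha_pos by (intro mult_left_mono) auto
    then show ?thesis by (simp add: mult_ac)
  qed
  also have "\<dots> = ?B\<^sup>2 / (4 * n)" 
  proof -
    have "s * (\<alpha> ^ d / (32 * y)) = s * (n * \<alpha> ^ d / (8 * y)) / (4 * real n)" if "y > 0" for s y :: real
      using that n0 by (simp add: field_simps)
    from this[of "real (d + 1)" "slack * c"] show ?thesis unfolding B2 count_bound_def by simp
  qed
  finally have E1: "?E \<le> ?B\<^sup>2 / (4 * n)" .
  also have "?B\<^sup>2 / (4 * n) \<le> count_bound n d"
  proof -
    have "slack * c \<le> 1 * real n"
      using slack_pos slack_le c by (intro mult_mono) auto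
    then have "slack * c * count_bound n d \<le> n * count_bound n d"
      using count_bound_pos[OF n0, of d] by (intro mult_right_mono) auto
    then have "?B\<^sup>2 / (4 * n) \<le> (n * count_bound n d) / (4 * n)"
      unfolding B2 by (intro divide_right_mono) auto
    also have "\<dots> \<le> count_bound n d" using n0 count_bound_pos[OF n0, of d] by simp
    finally show ?thesis .
  qed
  finally have E2: "?E \<le> count_bound n d" .
  have "pr n (\<lambda>w. \<not> typical d ?B w) \<le>
      2 * CARD('a) ^ d * (exp (- count_bound n d) + 2 * CARD('a) * exp (- (?B\<^sup>2 / (4 * n))))"
    using pr_not_typical_le[OF A n B0 Bn] by simp
  also have "\<dots> \<le> 2 * CARD('a) ^ d * (exp (- ?E) + 2 * CARD('a) * exp (- ?E))"
    using E1 E2 by (intro mult_left_mono add_mono) auto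
  finally show ?thesis by (simp add: algebra_simps)
qed

end

section \<open>Consistency of the estimator\<close>

definition optimal_tree :: "nat \<Rightarrow> 'a::finite list \<Rightarrow> real \<Rightarrow> 'a seq set \<Rightarrow> bool" where
  "optimal_tree d xs c T \<longleftrightarrow> T \<in> feasible_trees d xs \<and>
     (\<forall>T'\<in>feasible_trees d xs. tree_cost d xs c T \<le> tree_cost d xs c T')"

context positive_process
begin

text \<open>\<open>\<eta>\<close> and \<open>k\<close> are the thresholds for "\<open>f(n) / n\<close> is small" and "\<open>d(n)\<close> is large", with \<open>c\<close> in the
  place of \<open>f(n)\<close>.\<close>

definition typical_fit :: "real \<Rightarrow> nat \<Rightarrow> nat \<Rightarrow> 'a list \<Rightarrow> real \<Rightarrow> 'a seq set \<Rightarrow> bool" where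
  "typical_fit \<eta> k d xs c T \<longleftrightarrow> k \<le> d \<and> xs \<noteq> [] \<and> 0 < c \<and> c < \<eta> * length xs \<and>
     typical d (deviation_bound c d (length xs)) xs \<and> optimal_tree d xs c T"

lemma typical_fit_mono:
  assumes "typical_fit \<eta> k d xs c T" "\<eta> \<le> \<eta>'" "k' \<le> k"
  shows "typical_fit \<eta>' k' d xs c T"
proof -
  have "\<eta> * length xs \<le> \<eta>' * length xs" using assms(2) by (intro mult_right_mono) auto
  then have "c < \<eta>' * length xs" using assms(1) unfolding typical_fit_def by linarith
  then show ?thesis using assms unfolding typical_fit_def by simp
qed

lemma typical_word_count_pos:
  assumes "typical d B w" "length v \<le> d" "w \<noteq> []"
  shows "word_count d w v \<ge> 1"
proof -
  have "0 < count_bound (length w) (length v)" using assms(3) by (intro count_bound_pos) simp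
  also have "\<dots> < word_count d w v" by (rule typicalD(1)[OF assms(1,2)])
  finally show ?thesis by simp
qed

text \<open>Let \<open>r\<close> be the constant value of the kernel on the pasts ending in \<open>s\<close>. The maximum
  likelihood at \<open>s\<close> is at least that under \<open>r\<close>, and each leaf below \<open>s\<close> exceeds
  the likelihood under \<open>r\<close> by at most \<open>c / 4\<close>. With \<open>m \<ge> 2\<close> leaves, pruning at \<open>s\<close> saves \<open>(m - 1) c \<ge> m c / 2\<close> in penalties
  and loses at most \<open>m c / 4\<close> in likelihood.\<close>

lemma no_overestimation:
  assumes A: "CARD('a) \<ge> 2" and s: "\<not> internal T0 s" "length s \<le> d"
    and xs: "xs \<noteq> []" and c: "c > 0"
    and typl: "typical d (deviation_bound c d (length xs)) xs"
    and opt: "optimal_tree d xs c T"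
  shows "\<not> internal T s"
proof
  assume int: "internal T s"
  let ?n = "length xs" and ?B = "deviation_bound c d (length xs)" and ?N = "word_count d xs"
  let ?p = "\<lambda>v a. emp_prob d xs a v"
  define S where "S = {v. Fin v \<in> T \<and> suffix s v}"
  have n0: "?n > 0" using xs by simp
  have feas: "T \<in> feasible_trees d xs" using opt by (simp add: optimal_tree_def)
  then have tree: "is_tree T" "complete_tree T" by (auto simp: feasible_trees_def)
  note words = feasible_finite_words[OF feas]
  have finS: "finite S" unfolding S_def by (rule finite_subset[OF _ words(4)]) auto
  have S: "subtree_at s S"
    unfolding S_def using tree int words(1) by (intro subtree_at_below) auto
  have card: "card S \<ge> 2"
    unfolding S_def using tree int words(1) finS A S_def by (intro internal_two_leaves) auto
  have len: "length v \<le> d" "suffix s v" if "v \<in> S" for v using that words(2) by (auto simp: S_def)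
  have pos: "?N v \<ge> 1" if "length v \<le> d" for v by (rule typical_word_count_pos[OF typl that xs])
  obtain x where x: "x \<in> cylinder s" using cylinder_nonempty by blast
  define r where "r = pmf (q x)"
  have const: "pmf (q y) a = r a" if "y \<in> cylinder v" "suffix s v" for y v a
    using s(1) x cylinder_mono[OF that(2,1)] unfolding internal_context_tree_iff r_def by metis
  have r: "r a \<ge> \<alpha>" "r a > 0" for a
    using kernel_ge_cont_coeff_0[of x a] alpha_pos by (auto simp: r_def)
  have r1: "sum r UNIV = 1" by (simp add: r_def sum_pmf_eq_1)
  have p: "sum (?p v) UNIV = 1" if "length v \<le> d" for v using pos[OF that] by (intro sum_emp_prob) simp
  have B2: "?B\<^sup>2 = slack * c * count_bound ?n d"
    using slack_pos c count_bound_pos[OF n0, of d] by (simp add: deviation_bound_def)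
  have B0: "?B \<ge> 0" using slack_pos c count_bound_pos[OF n0, of d] by (simp add: deviation_bound_def)
  have small: "?N v * kl_div (?p v) r \<le> c / 4" if v: "v \<in> S" for v
  proof -
    let ?Nv = "real (?N v)"
    have N: "?Nv > 0" "count_bound ?n d \<le> ?Nv"
      using pos[OF len(1)[OF v]] typicalD(1)[OF typl len(1)[OF v]] count_bound_antimono[OF len(1)[OF v], of ?n]
      by auto
    have dev: "(?Nv * (?p v a - r a))\<^sup>2 \<le> ?B\<^sup>2" for a
    proof -
      have "kernel_sup v a \<le> r a" "r a \<le> kernel_inf v a"
        using const len(2)[OF v] by (auto intro!: kernel_supI kernel_infI)
      then have "kernel_sup v a * ?Nv \<le> r a * ?Nv" "r a * ?Nv \<le> kernel_inf v a * ?Nv"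
        using N(1) by (auto intro: mult_right_mono)
      then have "\<bar>real (letter_count d xs v a) - r a * ?Nv\<bar> \<le> ?B"
        using typicalD(2,3)[OF typl len(1)[OF v], of a] by linarith
      then have "\<bar>?Nv * (?p v a - r a)\<bar> \<le> \<bar>?B\<bar>"
        using B0 by (simp add: letter_count_emp_prob algebra_simps)
      then show ?thesis by (simp only: abs_le_square_iff)
    qed
    have "?Nv * kl_div (?p v) r \<le> ?Nv * (\<Sum>a\<in>UNIV. (?p v a - r a)\<^sup>2 / r a)"
      using r p[OF len(1)[OF v]] r1 by (intro mult_left_mono kl_div_le) auto
    also have "\<dots> = (\<Sum>a\<in>UNIV. (?Nv * (?p v a - r a))\<^sup>2 / (?Nv * r a))"
      
    proof -
      have "M * (z\<^sup>2 / t) = (M * z)\<^sup>2 / (M * t)" if "M > 0" for M z t :: real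
        using that by (simp add: power2_eq_square)
      from this[OF N(1)] show ?thesis unfolding sum_distrib_left by (intro sum.cong refl)
    qed
    also have "\<dots> \<le> (\<Sum>a\<in>(UNIV::'a set). ?B\<^sup>2 / (count_bound ?n d * \<alpha>))"
      using dev N r count_bound_pos[OF n0, of d] alpha_pos
      by (intro sum_mono frac_le mult_mono mult_pos_pos) auto
    also have "\<dots> = c / 4"
      using count_bound_pos[OF n0, of d] alpha_pos unfolding B2 by (simp add: slack_def)
    finally show ?thesis .
  qed
  have "(\<Sum>v\<in>S. c - log_lik d xs v) \<le> (\<Sum>v\<in>{s}. c - log_lik d xs v)"
    unfolding S_def using opt int s(2) pos subtree_at_singleton
    by (intro cost_graft[OF feas]) (auto simp: optimal_tree_def)
  moreover have "log_lik d xs s \<ge> (\<Sum>a\<in>UNIV. letter_count d xs s a * ln (r a))"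
  proof -
    have "0 \<le> (?p s undefined - r undefined)\<^sup>2 / 4" by simp
    also have "\<dots> \<le> kl_div (?p s) r" using r r1 p[OF s(2)] less_imp_le by (intro kl_div_ge) auto
    finally show ?thesis unfolding log_lik_kl_div[of d xs s r] by simp
  qed
  moreover have "(\<Sum>v\<in>S. ?N v * kl_div (?p v) r) \<le> card S * (c / 4)"
    using small by (intro sum_bounded_above)
  ultimately have "card S * c \<le> c + card S * (c / 4)"
    using sum_log_lik_subtree[OF S finS len(1) s(2), of xs r] by (simp add: sum_subtractf)
  then have "card S * c * 3 \<le> 4 * c" by simp
  moreover have "2 * c \<le> card S * c" using card c by (intro mult_right_mono) auto
  ultimately show False using c by linarith
qed

text \<open>Two pasts that end in \<open>w\<close> have different kernel values at some letter \<open>a\<close>. By continuity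
  the difference persists on all pasts sharing their last \<open>k\<close> letters, so on typical samples the
  empirical probabilities of \<open>a\<close> after the corresponding words \<open>v1\<close> and \<open>v2\<close> stay apart. One of
  them is then away from the empirical probability after \<open>w\<close>. As \<open>k\<close> is fixed, that word has a
  count linear in \<open>n\<close>, and so has the likelihood gained by growing all words of length \<open>k\<close>
  below \<open>w\<close>.\<close>

lemma no_underestimation:
  assumes cont: "(\<lambda>k. cont_coeff M X q k) \<longlonglongrightarrow> 1" and w: "internal T0 w"
  shows "\<exists>\<eta>>0. \<exists>k. \<forall>d xs c T. typical_fit \<eta> k d xs c T \<longrightarrow> Fin w \<notin> T"
proof -
  obtain x y where xy: "x \<in> cylinder w" "y \<in> cylinder w" "q x \<noteq> q y"
    using w unfolding internal_context_tree_iff by blast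
  obtain x y a where xy: "x \<in> cylinder w" "y \<in> cylinder w" "pmf (q y) a < pmf (q x) a"
    using xy by (metis linorder_neqE_linordered_idom pmf_eqI)
  define \<delta> where "\<delta> = pmf (q x) a - pmf (q y) a"
  have \<delta>: "\<delta> > 0" using xy by (simp add: \<delta>_def)
  have "\<forall>\<^sub>F k in sequentially. cont_coeff M X q k > 1 - \<delta> / 4"
    using cont \<delta> by (intro order_tendstoD(1)[OF cont]) auto
  then obtain k0 where k0: "\<And>k. k \<ge> k0 \<Longrightarrow> cont_coeff M X q k > 1 - \<delta> / 4"
    unfolding eventually_sequentially by blast
  define k where "k = k0 + length w + 1"
  have k: "k \<ge> 1" "length w \<le> k" "1 - cont_coeff M X q k < \<delta> / 4"
    using k0[of k] by (auto simp: k_def)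
  define v1 where "v1 = recent x k"
  define v2 where "v2 = recent y k"
  have lv: "length v1 = k" "length v2 = k" by (auto simp: v1_def v2_def)
  have cyl: "x \<in> cylinder v1" "y \<in> cylinder v2" by (auto simp: v1_def v2_def)
  have suf: "suffix w v1" "suffix w v2"
    using cylinder_comparable[OF xy(1) cyl(1)] cylinder_comparable[OF xy(2) cyl(2)] k lv by auto
  have gap: "kernel_sup v2 a + \<delta> / 2 \<le> kernel_inf v1 a"
  proof -
    have "pmf (q x) a - \<delta> / 4 \<le> pmf (q z) a" if "z \<in> cylinder v1" for z
      using kernel_continuity[OF k(1) lv(1) cyl(1) that, of a] k(3) by linarith
    then have 1: "pmf (q x) a - \<delta> / 4 \<le> kernel_inf v1 a" by (rule kernel_infI)
    have "pmf (q z) a \<le> pmf (q y) a + \<delta> / 4" if "z \<in> cylinder v2" for z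
      using kernel_continuity[OF k(1) lv(2) that cyl(2), of a] k(3) by linarith
    then have 2: "kernel_sup v2 a \<le> pmf (q y) a + \<delta> / 4" by (rule kernel_supI)
    from 1 2 show ?thesis unfolding \<delta>_def by (simp add: field_simps)
  qed
  define \<kappa> where "\<kappa> = \<alpha> ^ k / (8 * (k + 1))"
  have \<kappa>: "\<kappa> > 0" using alpha_pos by (simp add: \<kappa>_def)
  define S where "S = {v::'a list. length v = k \<and> suffix w v}"
  have finS: "finite S" unfolding S_def by (rule finite_subset[OF _ finite_words[of k]]) auto
  have S: "subtree_at w S" unfolding S_def by (rule subtree_at_level[OF k(2)])
  have vS: "v1 \<in> S" "v2 \<in> S" using lv suf by (auto simp: S_def)
  then have cardS: "card S > 0" using finS by (auto simp: card_gt_0_iff)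
  \<comment> \<open>The first bound makes the relative deviation \<open>B / N\<close> at most \<open>\<delta> / 8\<close>; the second makes the
    additional penalties smaller than the likelihood gain.\<close>
  define \<eta> where "\<eta> = min ((\<kappa> * \<delta> / 8)\<^sup>2) (\<kappa> * \<delta>\<^sup>2 / (256 * card S))"
  have \<eta>: "\<eta> > 0" using \<kappa> \<delta> cardS by (simp add: \<eta>_def)
  have "Fin w \<notin> T" if kd: "k \<le> d" and xs: "xs \<noteq> []" and c: "0 < c" "c < \<eta> * length xs"
      and typl: "typical d (deviation_bound c d (length xs)) xs" and opt: "optimal_tree d xs c T"
    for d xs c T
  proof
    assume wT: "Fin w \<in> T"
    let ?n = "length xs" and ?B = "deviation_bound c d (length xs)" and ?N = "word_count d xs"
    let ?p = "\<lambda>v a. emp_prob d xs a v"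
    have n0: "?n > 0" using xs by simp
    have cb: "count_bound ?n k = \<kappa> * ?n" by (simp add: count_bound_def \<kappa>_def mult.commute add.commute)
    have feas: "T \<in> feasible_trees d xs" using opt by (simp add: optimal_tree_def)
    then have tree: "is_tree T" by (auto simp: feasible_trees_def)
    have len: "length v \<le> d" if "v \<in> S" for v using that kd by (simp add: S_def)
    have wd: "length w \<le> d" using k kd by simp
    have pos: "?N v \<ge> 1" if "length v \<le> d" for v by (rule typical_word_count_pos[OF typl that xs])
    have N: "\<kappa> * ?n < ?N v" if "v \<in> S" for v
      using typicalD(1)[OF typl len[OF that]] that cb by (simp add: S_def)
    have B0: "?B \<ge> 0" using slack_pos c count_bound_pos[OF n0, of d] by (simp add: deviation_bound_def)
    have B: "?B \<le> \<kappa> * ?n * (\<delta> / 8)"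
    proof (rule power2_le_imp_le)
      have "?B\<^sup>2 = slack * c * count_bound ?n d"
        using slack_pos c count_bound_pos[OF n0, of d] by (simp add: deviation_bound_def)
      also have "\<dots> \<le> 1 * (\<eta> * ?n) * ?n"
        using slack_pos slack_le c \<eta> count_bound_le[of ?n d] count_bound_pos[OF n0, of d]
        by (intro mult_mono) auto
      also have "\<dots> \<le> 1 * ((\<kappa> * \<delta> / 8)\<^sup>2 * ?n) * ?n"
        by (intro mult_right_mono mult_left_mono) (auto simp: \<eta>_def)
      also have "\<dots> = (\<kappa> * ?n * (\<delta> / 8))\<^sup>2" by (simp add: power2_eq_square)
      finally show "?B\<^sup>2 \<le> (\<kappa> * ?n * (\<delta> / 8))\<^sup>2" .
    qed (use \<kappa> \<delta> in auto)
    have B': "?B / ?N v \<le> \<delta> / 8" if "v \<in> S" for v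
    proof -
      have "\<kappa> * ?n * (\<delta> / 8) \<le> ?N v * (\<delta> / 8)" using N[OF that] \<delta> by (intro mult_right_mono) auto
      then show ?thesis using B pos[OF len[OF that]] by (simp add: field_simps)
    qed
    have "kernel_inf v1 a - ?B / ?N v1 \<le> ?p v1 a"
      using typicalD(3)[OF typl len[OF vS(1)], of a] pos[OF len[OF vS(1)]]
      by (simp add: letter_count_emp_prob field_simps)
    moreover have "?p v2 a \<le> kernel_sup v2 a + ?B / ?N v2"
      using typicalD(2)[OF typl len[OF vS(2)], of a] pos[OF len[OF vS(2)]]
      by (simp add: letter_count_emp_prob field_simps)
    ultimately have "?p v2 a + \<delta> / 4 \<le> ?p v1 a"
      using gap B'[OF vS(1)] B'[OF vS(2)] by linarith
    then have "\<delta> / 8 \<le> \<bar>?p v1 a - ?p w a\<bar> \<or> \<delta> / 8 \<le> \<bar>?p v2 a - ?p w a\<bar>" by linarith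
    then obtain v where v: "v \<in> S" "\<delta> / 8 \<le> \<bar>?p v a - ?p w a\<bar>" using vS by blast
    have kl: "(?p u a - ?p w a)\<^sup>2 / 4 \<le> kl_div (?p u) (?p w)" if u: "u \<in> S" for u
    proof (rule kl_div_ge)
      show "sum (?p u) UNIV = 1" "sum (?p w) UNIV = 1"
        using pos[OF len[OF u]] pos[OF wd] by (auto intro!: sum_emp_prob)
      show "?p w b > 0" if "?p u b > 0" for b
      proof -
        have "letter_count d xs u b > 0" using that by (cases "letter_count d xs u b = 0") (auto simp: emp_prob_def)
        moreover have "letter_count d xs w b = (\<Sum>v\<in>S. letter_count d xs v b)"
          by (rule letter_count_subtree[OF S finS len wd])
        then have "letter_count d xs u b \<le> letter_count d xs w b"
          using member_le_sum[OF u, of "\<lambda>v. letter_count d xs v b"] finS by simp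
        ultimately show ?thesis by (intro emp_prob_pos) simp
      qed
    qed auto
    have kl0: "0 \<le> kl_div (?p u) (?p w)" if "u \<in> S" for u
      using kl[OF that] by (rule order_trans[rotated]) simp
    have "(\<delta> / 8)\<^sup>2 \<le> \<bar>?p v a - ?p w a\<bar>\<^sup>2" using v \<delta> by (intro power_mono) auto
    then have "(\<delta> / 8)\<^sup>2 / 4 \<le> kl_div (?p v) (?p w)" using kl[OF v(1)] by simp
    then have "\<kappa> * ?n * ((\<delta> / 8)\<^sup>2 / 4) \<le> ?N v * kl_div (?p v) (?p w)"
      using N[OF v(1)] \<kappa> by (intro mult_mono) auto
    also have "\<dots> \<le> (\<Sum>v\<in>S. ?N v * kl_div (?p v) (?p w))"
      using v(1) finS kl0 by (intro member_le_sum) auto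
    also have "\<dots> = (\<Sum>v\<in>S. log_lik d xs v) - log_lik d xs w"
      using sum_log_lik_subtree[OF S finS len wd, of xs "?p w"] by (simp add: log_lik_def)
    also have "\<dots> \<le> card S * c - c"
    proof -
      have "v = w" if "Fin v \<in> T" "suffix w v" for v
        using tree wT that unfolding is_tree_def by (metis prec_Fin_Fin suffix_order.le_less)
      then have "{v. Fin v \<in> T \<and> suffix w v} = {w}" using wT by auto
      then have "(\<Sum>v\<in>{w}. c - log_lik d xs v) \<le> (\<Sum>v\<in>S. c - log_lik d xs v)"
        using cost_graft[OF feas _ _ S finS len, of c] opt wT pos[OF len]
        by (simp add: optimal_tree_def)
      then show ?thesis by (simp add: sum_subtractf)
    qed
    also have "\<dots> < card S * c" using c by simp
    also have "\<dots> \<le> card S * (\<kappa> * \<delta>\<^sup>2 / (256 * card S) * ?n)"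
    proof -
      have "c \<le> \<eta> * ?n" using c by simp
      also have "\<dots> \<le> \<kappa> * \<delta>\<^sup>2 / (256 * card S) * ?n" by (intro mult_right_mono) (auto simp: \<eta>_def)
      finally show ?thesis by (intro mult_left_mono) auto
    qed
    also have "\<dots> = \<kappa> * ?n * ((\<delta> / 8)\<^sup>2 / 4)" using cardS by (simp add: power2_eq_square field_simps)
    finally show False by simp
  qed
  then show ?thesis using \<eta> unfolding typical_fit_def by blast
qed

text \<open>Only finitely many words have length at most \<open>K\<close>, so the thresholds can be chosen uniformly.
  An internal node of the context tree has only internal suffixes. None of them is a leaf of the
  optimal tree, which therefore has the node as an internal node by completeness.\<close>

lemma truncation_eq_of_typical:
  assumes A: "CARD('a) \<ge> 2" and cont: "(\<lambda>k. cont_coeff M X q k) \<longlonglongrightarrow> 1"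
  shows "\<exists>\<eta>>0. \<exists>k. \<forall>d xs c T. typical_fit \<eta> k d xs c T \<longrightarrow>
    truncation T K = truncation T0 K"
proof -
  let ?W = "{w::'a list. length w \<le> K \<and> internal T0 w}"
  have "\<forall>w\<in>?W. \<exists>\<eta>>0. \<exists>k. \<forall>d xs c T. typical_fit \<eta> k d xs c T \<longrightarrow> Fin w \<notin> T"
    using no_underestimation[OF cont] by blast
  then obtain \<eta> where "\<forall>w\<in>?W. \<eta> w > 0 \<and> (\<exists>k. \<forall>d xs c T. typical_fit (\<eta> w) k d xs c T \<longrightarrow> Fin w \<notin> T)"
    using bchoice[of ?W "\<lambda>w \<eta>. \<eta> > 0 \<and> (\<exists>k. \<forall>d xs c T. typical_fit \<eta> k d xs c T \<longrightarrow> Fin w \<notin> T)"] by blast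
  then obtain k where *: "\<And>w d xs c T. w \<in> ?W \<Longrightarrow> typical_fit (\<eta> w) (k w) d xs c T \<Longrightarrow> Fin w \<notin> T"
      and \<eta>_pos: "\<And>w. w \<in> ?W \<Longrightarrow> \<eta> w > 0"
    using bchoice[of ?W "\<lambda>w k. \<forall>d xs c T. typical_fit (\<eta> w) k d xs c T \<longrightarrow> Fin w \<notin> T"] by blast
  have fin: "finite ?W" by (rule finite_subset[OF _ finite_short_words[of K]]) auto
  define \<eta>0 where "\<eta>0 = Min (insert 1 (\<eta> ` ?W))"
  define k0 where "k0 = Max (insert K (k ` ?W))"
  have \<eta>0: "\<eta>0 > 0" using fin \<eta>_pos by (auto simp: \<eta>0_def)
  have \<eta>0_le: "\<eta>0 \<le> \<eta> w" and k0_ge: "k w \<le> k0" if "w \<in> ?W" for w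
    using fin that by (auto simp: \<eta>0_def k0_def)
  have Kk: "K \<le> k0" using fin by (auto simp: k0_def)
  have "truncation T K = truncation T0 K"
    if fit: "typical_fit \<eta>0 k0 d xs c T" for d xs c T
  proof (rule truncation_eqI)
    have kd: "k0 \<le> d" and xs: "xs \<noteq> []" and c: "0 < c"
      and typl: "typical d (deviation_bound c d (length xs)) xs" and opt: "optimal_tree d xs c T"
      using fit by (auto simp: typical_fit_def)
    have "T \<in> feasible_trees d xs" using opt by (simp add: optimal_tree_def)
    then show tree: "is_tree T" "complete_tree T" by (auto simp: feasible_trees_def)
    show "is_tree T0" "complete_tree T0" by (rule is_tree_context_tree complete_context_tree)+
    fix s :: "'a list" assume s: "length s < K"
    show "internal T s \<longleftrightarrow> internal T0 s"
    proof (rule iffI)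
      assume "internal T s"
      then show "internal T0 s"
        using no_overestimation[OF A _ _ xs c typl opt, of s] s Kk kd by auto
    next
      assume int: "internal T0 s"
      have "Fin t \<notin> T" if "suffix t s" for t
      proof -
        have t: "t \<in> ?W"
          using that int internal_suffix suffix_length_le[OF that] s by auto
        then have "typical_fit (\<eta> t) (k t) d xs c T"
          using typical_fit_mono[OF fit] \<eta>0_le k0_ge by blast
        with t show ?thesis by (rule *)
      qed
      then show "internal T s" using internal_or_leaf_suffix[OF tree(2), of s] by blast
    qed
  qed
  then show ?thesis using \<eta>0 by blast
qed

end

text \<open>The summands tend to zero, so \<open>C\<^bsup>d\<^esup> < exp (f / d)\<close> eventually. Hence \<open>d\<^sup>2\<close> is bounded by a multiple
  of \<open>f(n) \<le> n\<close>.\<close>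

lemma height_small:
  fixes f :: "nat \<Rightarrow> real" and C :: real
  assumes d: "filterlim d at_top sequentially" and f: "\<forall>\<^sub>F n in sequentially. f n \<le> n" and C: "C \<ge> 2"
    and sm: "summable (\<lambda>n. C ^ d n * exp (- (f n * 1 ^ d n / real (d n))))"
  shows "\<forall>\<^sub>F n in sequentially. 4 * (d n + 1) \<le> n"
proof -
  have "\<forall>\<^sub>F n in sequentially. C ^ d n * exp (- (f n * 1 ^ d n / real (d n))) < 1"
    using summable_LIMSEQ_zero[OF sm] by (rule order_tendstoD(2)) simp
  moreover have "\<forall>\<^sub>F n in sequentially. d n \<ge> 1"
    using d by (simp add: filterlim_at_top)
  moreover have "\<forall>\<^sub>F n in sequentially. n \<ge> 128" by (rule eventually_ge_at_top)
  ultimately show ?thesis using f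
  proof eventually_elim
    case (elim n)
    have "exp (1 / 2 :: real) \<le> 2" using exp_bound[of "1 / 2 :: real"] by (simp add: power2_eq_square)
    then have "exp (1 / 2) ^ d n \<le> C ^ d n" using C by (intro power_mono) auto
    then have "exp (d n / 2) \<le> C ^ d n" by (simp add: exp_of_nat_mult[symmetric])
    moreover have "C ^ d n < exp (f n / d n)" using elim(1) by (simp add: exp_minus field_simps)
    ultimately have "exp (d n / 2) < exp (f n / d n)" by linarith
    then have "d n / 2 < f n / d n" by simp
    then have "real (d n) * d n < 2 * f n" using elim(2) by (simp add: field_simps)
    then have "real (d n) * d n < 2 * n" using elim by linarith
    then have "real (d n * d n) < real (2 * n)" by simp
    then have dd: "d n * d n < 2 * n" by (simp only: of_nat_less_iff)
    have "(4 * (d n + 1))\<^sup>2 \<le> (8 * d n)\<^sup>2" using elim(2) by (intro power_mono) auto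
    also have "\<dots> = 64 * (d n * d n)" by (simp add: power2_eq_square)
    also have "\<dots> \<le> 128 * n" using dd by simp
    also have "\<dots> \<le> n\<^sup>2" using elim(3) by (simp add: power2_eq_square)
    finally show ?case by (rule power2_le_imp_le) simp
  qed
qed

theorem corollary2p12:
  fixes M :: "'w measure"
    and X :: "int \<Rightarrow> 'w \<Rightarrow> 'a::finite"
    and q :: "(nat \<Rightarrow> 'a) \<Rightarrow> 'a pmf"
    and K :: nat
    and f :: "nat \<Rightarrow> real"
    and d :: "nat \<Rightarrow> nat"
    and That :: "'a list \<Rightarrow> 'a seq set"
  assumes "CARD('a) \<ge> 2"
    and "prob_space M"
    and "\<And>t. X t \<in> measurable M (count_space UNIV)"
    and "stationary M X"
    and "ergodic M X"
    and "cond_law_version M X q"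
    and "cont_coeff M X q 0 > 0"
    and "summable (\<lambda>k. 1 - cont_coeff M X q k)"
    and "penalizing_term f"
    and "\<And>n. n \<ge> 1 \<Longrightarrow> d n < n"
    and "filterlim d at_top sequentially"
    and "\<And>c::real. c > 0 \<Longrightarrow>
           summable (\<lambda>n. real CARD('a) ^ d n * exp (- (f n * c ^ d n / real (d n))))"
    and "pl_estimator f d That"
  shows "AE \<omega> in M. \<exists>n0. \<forall>n\<ge>n0.
           truncation (That (block X 1 (int n) \<omega>)) K = truncation (context_tree M X q) K"
proof -
  interpret prob_space M by fact
  interpret positive_process M X q by unfold_locales fact+
  have fpos: "f n > 0" for n using assms(9) by (simp add: penalizing_term_def)
  have f0: "(\<lambda>n. f n / real n) \<longlonglongrightarrow> 0" using assms(9) by (simp add: penalizing_term_def)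
  have f_small: "\<forall>\<^sub>F n in sequentially. f n < \<eta> * n" if "\<eta> > 0" for \<eta> :: real
    using order_tendstoD(2)[OF f0 that] eventually_gt_at_top[of 0]
    by eventually_elim (simp add: field_simps)
  have cont: "(\<lambda>k. cont_coeff M X q k) \<longlonglongrightarrow> 1"
    using tendsto_diff[OF tendsto_const[of 1] summable_LIMSEQ_zero[OF assms(8)]] by simp
  define B where "B n = deviation_bound (f n) (d n) n" for n
  define bnd where "bnd n = 2 * (1 + 2 * real CARD('a)) *
      (real CARD('a) ^ d n * exp (- (f n * (\<alpha> * slack / 64) ^ d n / real (d n))))" for n
  define bad where "bad n = {\<omega> \<in> space M. \<not> typical (d n) (B n) (block X 1 (int n) \<omega>)}" for n
  have d_large: "\<forall>\<^sub>F n in sequentially. k \<le> d n" for k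
    using assms(11) by (simp add: filterlim_at_top)
  have f_le: "\<forall>\<^sub>F n in sequentially. f n \<le> n" using f_small[of 1] by (simp add: eventually_mono)
  have "\<forall>\<^sub>F n in sequentially. 4 * (d n + 1) \<le> n"
    using assms(1) by (intro height_small[OF assms(11) f_le _ assms(12)[of 1]]) auto
  moreover note f_le d_large[of 1]
  ultimately have "\<forall>\<^sub>F n in sequentially. norm (prob (bad n)) \<le> bnd n"
  proof eventually_elim
    case (elim n)
    have "prob (bad n) = pr n (\<lambda>w. \<not> typical (d n) (B n) w)"
      unfolding bad_def by (rule prob_block_eq_pr)
    moreover have "norm (prob (bad n)) = prob (bad n)" by simp
    ultimately show ?case
      using pr_not_typical_penalty[OF assms(1) elim(1,3) fpos elim(2)] by (simp add: B_def bnd_def)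
  qed
  moreover have "summable bnd"
    unfolding bnd_def using alpha_pos slack_pos by (intro summable_mult assms(12)) auto
  ultimately have "summable (\<lambda>n. prob (bad n))"
    by (rule summable_comparison_test_ev)
  moreover have bad_sets: "bad n \<in> sets M" for n unfolding bad_def by (rule sets_block)
  ultimately have ae: "AE \<omega> in M. \<forall>\<^sub>F n in sequentially. \<omega> \<in> space M - bad n"
    by (intro borel_cantelli_AE1) (auto simp: emeasure_eq_measure)
  obtain \<eta> k where \<eta>: "\<eta> > 0"
    and main: "\<And>d xs c T. typical_fit \<eta> k d xs c T \<Longrightarrow> truncation T K = truncation T0 K"
    using truncation_eq_of_typical[OF assms(1) cont, of K] by blast
  from ae show ?thesis
  proof (rule AE_mp, intro AE_I2 impI)
    fix \<omega> assume "\<forall>\<^sub>F n in sequentially. \<omega> \<in> space M - bad n"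
    moreover note f_small[OF \<eta>] d_large[of k] eventually_gt_at_top[of "0::nat"]
    ultimately have "\<forall>\<^sub>F n in sequentially. truncation (That (block X 1 (int n) \<omega>)) K = truncation T0 K"
    proof eventually_elim
      case (elim n)
      let ?xs = "block X 1 (int n) \<omega>"
      have len: "length ?xs = n" by (simp add: block_def)
      then have ne: "?xs \<noteq> []" using elim(4) by auto
      have "optimal_tree (d n) ?xs (f n) (That ?xs)"
        using assms(13) ne unfolding pl_estimator_def is_arg_min_def optimal_tree_def tree_cost_def len
        by (metis len not_less)
      moreover have "typical (d n) (deviation_bound (f n) (d n) (length ?xs)) ?xs"
        using elim(1) by (simp add: bad_def B_def len)
      ultimately have "typical_fit \<eta> k (d n) ?xs (f n) (That ?xs)"
        using elim ne fpos by (simp add: typical_fit_def len)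
      then show ?case by (rule main)
    qed
    then show "\<exists>n0. \<forall>n\<ge>n0. truncation (That (block X 1 (int n) \<omega>)) K = truncation T0 K"
      by (simp add: eventually_sequentially)
  qed
qed

end
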